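(* Let $D$ be a division ring, $r,s\in\mathbb{N}$, $M=(m_1,\dots,m_r)\in\mathbb{N}^r$, $N=(n_1,\dots,n_s)\in\mathbb{N}^s$, $m=\sum_{i=1}^r m_i$ and $n=\sum_{j=1}^s n_j$. (i) Let $0\ne J\in\mathcal{LS}(\mathcal{T}_{(M,N)})$ with $\Phi(J)=(R_1,\dots,R_k,0_n,\dots,0_n)$, where $1\le k\le r$ is the largest index for which $R_k\ne 0_n$. Then $J$ is principal if and only if ${\rm rank}(R_i)-{\rm rank}(R_{i+1})\le m_i$ for each $1\le i\le k$. By convention, $R_{r+1}:=0_n$. (ii) Let $0\ne J\in\mathcal{RS}(\mathcal{T}_{(M,N)})$ with $\Phi(J)=(0_m,\dots,0_m,C_k,\dots,C_s)$, where $1\le k\le s$ is the smallest index for which $C_k\ne 0_m$. Then $J$ is principal if and only if ${\rm rank}(C_j)-{\rm rank}(C_{j-1})\le n_j$ for each $k\le j\le s$. By convention, $C_0:=0_m$.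
   Context: The nest module determined by $M$ and $N$ is $$\mathcal{T}_{(M,N)}:=\{(A_{ij}):1\le i\le r,\ 1\le j\le s,\ A_{ij}\in M_{m_i\times n_j}(D),\ A_{ij}=0\ \text{for all } i>j\}\subseteq M_{m\times n}(D),$$ and $\mathcal{T}_M:=\mathcal{T}_{(M,M)}$, $\mathcal{T}_N:=\mathcal{T}_{(N,N)}$. $\mathcal{T}_{(M,N)}$ is a $(\mathcal{T}_M,\mathcal{T}_N)$-bimodule via matrix multiplication. $\mathcal{LS}(\mathcal{T}_{(M,N)})$ and $\mathcal{RS}(\mathcal{T}_{(M,N)})$ denote the sets of its left $\mathcal{T}_M$-submodules and right $\mathcal{T}_N$-submodules, respectively. A left (resp. right) submodule $J$ is principal if $J=\mathcal{T}_MA$ (resp. $J=A\mathcal{T}_N$) for some $A\in\mathcal{T}_{(M,N)}$. ${\rm Row}_i(J)$ is the set of $i$th block rows (of height $m_i$) of elements of $J$, and ${\rm Col}_j(J)$ the set of $j$th block columns (of width $n_j$). $0_n$ is the $n\times n$ zero matrix. $\mathcal{R}_n$ is the set of $n\times n$ left row reduced echelon matrices over $D$: zero rows come last, the leading (first nonzero) entry of each nonzero row is $1$, the column positions of leading entries strictly increase with the row index, and each leading entry is the only nonzero entry of its column. $\mathcal{C}_m$ is the set of $m\times m$ right column reduced echelon matrices, defined by the same conditions with rows and columns interchanged. The rank of a matrix is the dimension of its left row space (the left $D$-span of its rows), equivalently of its right column space. For $J\in\mathcal{LS}(\mathcal{T}_{(M,N)})$, $\Phi(J)=(R_1,\dots,R_r)$,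 where $R_i$ is the unique element of $\mathcal{R}_n$ such that ${\rm Row}_i(J)=M_{m_i\times n}(D)R_i$; such $R_i$ exist, and the left row spaces of $R_1,\dots,R_r$ form a decreasing chain. For $J\in\mathcal{RS}(\mathcal{T}_{(M,N)})$, $\Phi(J)=(C_1,\dots,C_s)$, where $C_j$ is the unique element of $\mathcal{C}_m$ such that ${\rm Col}_j(J)=C_jM_{m\times n_j}(D)$; such $C_j$ exist, and the right column spaces of $C_1,\dots,C_s$ form an increasing chain. *)

theory Defs
  imports "Jordan_Normal_Form.Gauss_Jordan_Elimination" "Jordan_Normal_Form.DL_Submatrix"
begin

text \<open>
  Matrices are the carrier-based matrices of \<open>Jordan_Normal_Form.Matrix\<close>, with 0-based entries.
  A tuple of block sizes \<open>M = (m\<^sub>1, \<dots>, m\<^sub>r)\<close> is a function on \<open>nat\<close> of which only the values at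
  \<open>1, \<dots>, r\<close> matter; block indices are 1-based.
\<close>

text \<open>
  The vector spaces of the library are over fields, so left linear combinations, left span and
  left dimension are defined here for vectors with entries in a division ring. Scalars act on the
  left. The dimension follows the pattern of \<^const>\<open>vector_space.dim\<close>.
\<close>

definition left_lincomb :: "nat \<Rightarrow> ('a::division_ring vec \<Rightarrow> 'a) \<Rightarrow> 'a vec set \<Rightarrow> 'a vec" where
  "left_lincomb n c F = vec n (\<lambda>q. \<Sum>v\<in>F. c v * v $ q)"

definition left_span :: "nat \<Rightarrow> 'a::division_ring vec set \<Rightarrow> 'a vec set" where
  "left_span n S = {left_lincomb n c F | c F. finite F \<and> F \<subseteq> S}"

definition left_independent :: "nat \<Rightarrow> 'a::division_ring vec set \<Rightarrow> bool" where
  "left_independent n S \<longleftrightarrow>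
     (\<forall>c F. finite F \<and> F \<subseteq> S \<and> left_lincomb n c F = 0\<^sub>v n \<longrightarrow> (\<forall>v\<in>F. c v = 0))"

definition left_dim :: "nat \<Rightarrow> 'a::division_ring vec set \<Rightarrow> nat" where
  "left_dim n V = card (SOME B. B \<subseteq> V \<and> left_independent n B \<and> left_span n B = V)"

definition left_row_space :: "'a::division_ring mat \<Rightarrow> 'a vec set" where
  "left_row_space A = left_span (dim_col A) (set (rows A))"

definition mat_rank :: "'a::division_ring mat \<Rightarrow> nat" where
  "mat_rank A = left_dim (dim_col A) (left_row_space A)"

text \<open>
  Despite its name, the predicate \<^const>\<open>row_echelon_form\<close> of the library describes \<^emph>\<open>reduced\<close>
  row echelon matrices: leading entries are 1, are the only nonzero entries of their columns, move
  strictly to the right, and zero rows come last. These conditions involve no products, so the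
  column version is the one for the transposed matrix, also over a noncommutative ring.
\<close>

definition row_reduced_echelon :: "nat \<Rightarrow> 'a::division_ring mat set" where
  "row_reduced_echelon n = {R \<in> carrier_mat n n. row_echelon_form R}"

definition col_reduced_echelon :: "nat \<Rightarrow> 'a::division_ring mat set" where
  "col_reduced_echelon m = {C \<in> carrier_mat m m. row_echelon_form (transpose_mat C)}"

definition total_size :: "nat \<Rightarrow> (nat \<Rightarrow> nat) \<Rightarrow> nat" where
  "total_size r M = (\<Sum>i = 1..r. M i)"

definition block_indices :: "(nat \<Rightarrow> nat) \<Rightarrow> nat \<Rightarrow> nat set" where
  "block_indices M i = {total_size (i - 1) M ..< total_size i M}"

definition block :: "(nat \<Rightarrow> nat) \<Rightarrow> (nat \<Rightarrow> nat) \<Rightarrow> 'a mat \<Rightarrow> nat \<Rightarrow> nat \<Rightarrow> 'a mat" where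
  "block M N A i j = submatrix A (block_indices M i) (block_indices N j)"

definition block_row :: "(nat \<Rightarrow> nat) \<Rightarrow> nat \<Rightarrow> 'a mat \<Rightarrow> 'a mat" where
  "block_row M i A = submatrix A (block_indices M i) UNIV"

definition block_col :: "(nat \<Rightarrow> nat) \<Rightarrow> nat \<Rightarrow> 'a mat \<Rightarrow> 'a mat" where
  "block_col N j A = submatrix A UNIV (block_indices N j)"

definition nest_module ::
  "nat \<Rightarrow> (nat \<Rightarrow> nat) \<Rightarrow> nat \<Rightarrow> (nat \<Rightarrow> nat) \<Rightarrow> 'a::division_ring mat set" where
  "nest_module r M s N = {A \<in> carrier_mat (total_size r M) (total_size s N).
     \<forall>i\<in>{1..r}. \<forall>j\<in>{1..s}. i > j \<longrightarrow> block M N A i j = 0\<^sub>m (M i) (N j)}"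

abbreviation nest_ring :: "nat \<Rightarrow> (nat \<Rightarrow> nat) \<Rightarrow> 'a::division_ring mat set" where
  "nest_ring r M \<equiv> nest_module r M r M"

text \<open>The modules of the library are over commutative rings, hence the explicit closure conditions.\<close>

definition left_submodules ::
  "nat \<Rightarrow> (nat \<Rightarrow> nat) \<Rightarrow> nat \<Rightarrow> (nat \<Rightarrow> nat) \<Rightarrow> 'a::division_ring mat set set" where
  "left_submodules r M s N = {J. J \<subseteq> nest_module r M s N \<and>
     0\<^sub>m (total_size r M) (total_size s N) \<in> J \<and>
     (\<forall>A\<in>J. \<forall>B\<in>J. A + B \<in> J) \<and>
     (\<forall>T\<in>nest_ring r M. \<forall>A\<in>J. T * A \<in> J)}"

definition right_submodules ::
  "nat \<Rightarrow> (nat \<Rightarrow> nat) \<Rightarrow> nat \<Rightarrow> (nat \<Rightarrow> nat) \<Rightarrow> 'a::division_ring mat set set" where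
  "right_submodules r M s N = {J. J \<subseteq> nest_module r M s N \<and>
     0\<^sub>m (total_size r M) (total_size s N) \<in> J \<and>
     (\<forall>A\<in>J. \<forall>B\<in>J. A + B \<in> J) \<and>
     (\<forall>T\<in>nest_ring s N. \<forall>A\<in>J. A * T \<in> J)}"

definition left_principal ::
  "nat \<Rightarrow> (nat \<Rightarrow> nat) \<Rightarrow> nat \<Rightarrow> (nat \<Rightarrow> nat) \<Rightarrow> 'a::division_ring mat set \<Rightarrow> bool" where
  "left_principal r M s N J \<longleftrightarrow> (\<exists>A\<in>nest_module r M s N. J = {T * A | T. T \<in> nest_ring r M})"

definition right_principal ::
  "nat \<Rightarrow> (nat \<Rightarrow> nat) \<Rightarrow> nat \<Rightarrow> (nat \<Rightarrow> nat) \<Rightarrow> 'a::division_ring mat set \<Rightarrow> bool" where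
  "right_principal r M s N J \<longleftrightarrow> (\<exists>A\<in>nest_module r M s N. J = {A * T | T. T \<in> nest_ring s N})"

text \<open>
  \<open>left_Phi r M s N J i\<close> is the matrix \<open>R\<^sub>i\<close> and \<open>right_Phi r M s N J j\<close> the matrix \<open>C\<^sub>j\<close>. Outside
  the range of block indices both are zero, which covers the conventions \<open>R\<^bsub>r+1\<^esub> = 0\<close> and
  \<open>C\<^sub>0 = 0\<close>. For positive block sizes the definite descriptions are well-defined.
\<close>

definition left_Phi ::
  "nat \<Rightarrow> (nat \<Rightarrow> nat) \<Rightarrow> nat \<Rightarrow> (nat \<Rightarrow> nat) \<Rightarrow> 'a::division_ring mat set \<Rightarrow> nat \<Rightarrow> 'a mat" where
  "left_Phi r M s N J i = (let n = total_size s N in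
     if i \<in> {1..r}
     then THE R. R \<in> row_reduced_echelon n \<and>
       block_row M i ` J = {X * R | X. X \<in> carrier_mat (M i) n}
     else 0\<^sub>m n n)"

definition right_Phi ::
  "nat \<Rightarrow> (nat \<Rightarrow> nat) \<Rightarrow> nat \<Rightarrow> (nat \<Rightarrow> nat) \<Rightarrow> 'a::division_ring mat set \<Rightarrow> nat \<Rightarrow> 'a mat" where
  "right_Phi r M s N J j = (let m = total_size r M in
     if j \<in> {1..s}
     then THE C. C \<in> col_reduced_echelon m \<and>
       block_col N j ` J = {C * X | X. X \<in> carrier_mat m (N j)}
     else 0\<^sub>m m m)"

end

theory Submission
  imports Defs
begin

text \<open>
  A left submodule \<open>J\<close> consists of all matrices whose rows in the \<open>i\<close>th block lie in \<open>V\<^sub>i\<close>, the row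
  space of \<open>R\<^sub>i\<close>, and a matrix \<open>A\<close> generates \<open>J\<close> iff every \<open>V\<^sub>i\<close> is spanned by the rows of \<open>A\<close> in the
  blocks \<open>i, \<dots>, r\<close>. Such an \<open>A\<close> exists iff each \<open>V\<^sub>i\<close> arises from \<open>V\<^bsub>i+1\<^esub>\<close> by adjoining \<open>m\<^sub>i\<close> vectors,
  which is a condition on dimensions. The dimension of a subspace is computed as the number of
  positions at which its nonzero vectors have their first nonzero entry. Right submodules become
  left submodules over the opposite division ring by transposition, with the order of the blocks
  reversed; to cover both, all linear algebra is carried out for a multiplication that is either
  the given one or the flipped one.
\<close>

section \<open>Subspaces and leading positions\<close>

text \<open>Flipping the multiplication on the same type avoids a type for the opposite ring, and
  echelon conditions, which involve no products, mean the same for both multiplications. What is not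
  symmetric is \<open>mat_rank\<close>: it is the left row rank even for the matrices
  \<open>C_j\<close>, while the flipped linear algebra yields the right column dimension. The two
  are reconciled for echelon matrices only, where both count pivots. Counting leading positions
  gives a number that involves no choice of a basis and is monotone by definition. All that remains
  to be shown about it is that adjoining a vector outside a subspace raises it by exactly one;
  equality of nested subspaces of equal dimension, the bound for spans and the extension to a given
  subspace follow from that. The same positions serve as free coordinates on the subspace, which
  yields existence and uniqueness of the echelon matrices and so gives meaning to the definite
  descriptions in \<open>left_Phi\<close> and \<open>right_Phi\<close>.\<close>

locale twisted_mult =
  fixes mul :: "'a::division_ring \<Rightarrow> 'a \<Rightarrow> 'a" (infixl "\<star>" 70)
  assumes mul_cases: "mul = (*) \<or> mul = (\<lambda>a b. b * a)"
begin

lemma mul_assoc: "(a \<star> b) \<star> c = a \<star> (b \<star> c)"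
  and mul_add: "a \<star> (b + c) = a \<star> b + a \<star> c"
  and add_mul: "(a + b) \<star> c = a \<star> c + b \<star> c"
  and mul_zero [simp]: "a \<star> 0 = 0"
  and zero_mul [simp]: "0 \<star> a = 0"
  and mul_one [simp]: "a \<star> 1 = a"
  and one_mul [simp]: "1 \<star> a = a"
  and minus_mul [simp]: "(- a) \<star> b = - (a \<star> b)"
  and mul_eq_0_iff [simp]: "a \<star> b = 0 \<longleftrightarrow> a = 0 \<or> b = 0"
  using mul_cases by (auto simp: algebra_simps)

lemma inverse_mul: "a \<noteq> 0 \<Longrightarrow> inverse a \<star> a = 1"
  using mul_cases by auto

text \<open>For the flipped multiplication this multiplies by \<open>c\<close> from the right, so
  that \<open>subspace\<close> then means right subspace.\<close>

definition smul :: "'a \<Rightarrow> 'a vec \<Rightarrow> 'a vec" where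
  "smul c v = vec (dim_vec v) (\<lambda>q. c \<star> v $ q)"

lemma dim_smul [simp]: "dim_vec (smul c v) = dim_vec v"
  and smul_index [simp]: "q < dim_vec v \<Longrightarrow> smul c v $ q = c \<star> v $ q"
  and smul_carrier [simp, intro]: "v \<in> carrier_vec n \<Longrightarrow> smul c v \<in> carrier_vec n"
  by (auto simp: smul_def)

definition subspace :: "nat \<Rightarrow> 'a vec set \<Rightarrow> bool" where
  "subspace n V \<longleftrightarrow> V \<subseteq> carrier_vec n \<and> 0\<^sub>v n \<in> V \<and>
     (\<forall>v\<in>V. \<forall>w\<in>V. v + w \<in> V) \<and> (\<forall>c. \<forall>v\<in>V. smul c v \<in> V)"

definition leads :: "nat \<Rightarrow> 'a vec \<Rightarrow> bool" where
  "leads q v \<longleftrightarrow> v $ q \<noteq> 0 \<and> (\<forall>q'<q. v $ q' = 0)"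

text \<open>Entries beyond the dimension of a vector are unspecified, hence the bound
  \<open>q < n\<close>.\<close>

definition pivots :: "nat \<Rightarrow> 'a vec set \<Rightarrow> nat set" where
  "pivots n V = {q. q < n \<and> (\<exists>v\<in>V. leads q v)}"

text \<open>For a subspace this is the dimension, by elimination.\<close>

definition pdim :: "nat \<Rightarrow> 'a vec set \<Rightarrow> nat" where
  "pdim n V = card (pivots n V)"

definition adjoin :: "'a vec set \<Rightarrow> 'a vec \<Rightarrow> 'a vec set" where
  "adjoin V x = {v + smul c x | v c. v \<in> V}"

text \<open>An indexed family instead of a set of vectors, because the rows of a matrix may
  repeat.\<close>

definition lc :: "nat \<Rightarrow> 'i set \<Rightarrow> ('i \<Rightarrow> 'a) \<Rightarrow> ('i \<Rightarrow> 'a vec) \<Rightarrow> 'a vec" where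
  "lc n I c u = vec n (\<lambda>q. \<Sum>p\<in>I. c p \<star> u p $ q)"

text \<open>A span relative to \<open>W\<close>; the ordinary span is the case of the zero
  subspace.\<close>

definition extend :: "nat \<Rightarrow> 'a vec set \<Rightarrow> 'i set \<Rightarrow> ('i \<Rightarrow> 'a vec) \<Rightarrow> 'a vec set" where
  "extend n W I u = {w + lc n I c u | w c. w \<in> W}"

lemma subspaceD:
  assumes "subspace n V"
  shows "v \<in> V \<Longrightarrow> v \<in> carrier_vec n" "v \<in> V \<Longrightarrow> dim_vec v = n" "0\<^sub>v n \<in> V"
    "v \<in> V \<Longrightarrow> w \<in> V \<Longrightarrow> v + w \<in> V" "v \<in> V \<Longrightarrow> smul c v \<in> V"
  using assms unfolding subspace_def by (blast, metis carrier_vecD subsetD, blast+)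

lemma subspace_zero: "subspace n {0\<^sub>v n}"
  unfolding subspace_def by (auto simp: smul_def intro!: eq_vecI)

lemma subspace_diff:
  assumes "subspace n V" "v \<in> V" "w \<in> V"
  shows "v - w \<in> V"
proof -
  have "v - w = v + smul (-1) w"
    using subspaceD(2)[OF assms(1)] assms(2,3) by (intro eq_vecI) auto
  then show ?thesis using subspaceD[OF assms(1)] assms(2,3) by metis
qed

lemma lc_dim [simp]: "dim_vec (lc n I c u) = n"
  and lc_carrier [simp, intro]: "lc n I c u \<in> carrier_vec n"
  and lc_index [simp]: "q < n \<Longrightarrow> lc n I c u $ q = (\<Sum>p\<in>I. c p \<star> u p $ q)"
  by (auto simp: lc_def)

lemma lc_insert:
  assumes "finite I" "k \<notin> I" "u k \<in> carrier_vec n"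
  shows "lc n (insert k I) c u = lc n I c u + smul (c k) (u k)"
  using assms by (intro eq_vecI) (auto simp: add.commute)

lemma lc_cong:
  assumes "\<And>p. p \<in> I \<Longrightarrow> c p = c' p" "\<And>p. p \<in> I \<Longrightarrow> u p = u' p"
  shows "lc n I c u = lc n I c' u'"
  using assms by (auto simp: lc_def intro!: eq_vecI sum.cong)

lemma subspace_lc:
  assumes "subspace n V" "finite I" "\<And>p. p \<in> I \<Longrightarrow> u p \<in> V"
  shows "lc n I c u \<in> V"
  using assms(2,3)
proof (induction I)
  case empty
  have "lc n {} c u = 0\<^sub>v n" by (intro eq_vecI) auto
  then show ?case using subspaceD[OF assms(1)] by simp
next
  case (insert k I)
  then show ?case using subspaceD[OF assms(1)] by (simp add: lc_insert)
qed

section \<open>Leading positions as coordinates on a subspace\<close>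

lemma leads_unique: "leads q v \<Longrightarrow> leads q' v \<Longrightarrow> q = q'"
  unfolding leads_def by (metis linorder_neqE_nat)

lemma ex_leads:
  assumes "v \<in> carrier_vec n" "v \<noteq> 0\<^sub>v n"
  shows "\<exists>q<n. leads q v"
proof -
  have "\<exists>q. q < n \<and> v $ q \<noteq> 0" using assms by (metis carrier_vecD eq_vecI index_zero_vec)
  then obtain q where q: "q < n \<and> v $ q \<noteq> 0" "\<forall>q'<q. \<not> (q' < n \<and> v $ q' \<noteq> 0)"
    using exists_least_iff[of "\<lambda>q. q < n \<and> v $ q \<noteq> 0"] by blast
  then show ?thesis unfolding leads_def by (meson order.strict_trans)
qed

lemma finite_pivots [simp]: "finite (pivots n V)"
  by (simp add: pivots_def)

lemma pivots_subset: "pivots n V \<subseteq> {..<n}"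
  by (auto simp: pivots_def)

lemma pdim_le: "pdim n V \<le> n"
  unfolding pdim_def using card_mono[OF _ pivots_subset] by fastforce

lemma pivots_mono: "W \<subseteq> V \<Longrightarrow> pivots n W \<subseteq> pivots n V"
  by (auto simp: pivots_def)

lemma pdim_mono: "W \<subseteq> V \<Longrightarrow> pdim n W \<le> pdim n V"
  by (simp add: card_mono pdim_def pivots_mono)

lemma pdim_zero: "pdim n {0\<^sub>v n} = 0"
  by (auto simp: pdim_def pivots_def leads_def)

text \<open>Prescribe the values from left to right: a vector of the subspace with leading position
  \<open>q\<close> corrects the entry at \<open>q\<close> without touching the earlier ones.\<close>

lemma ex_values_at_pivots:
  assumes V: "subspace n V"
  shows "\<exists>v\<in>V. \<forall>q\<in>pivots n V. v $ q = f q"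
proof -
  have "\<exists>v\<in>V. \<forall>q\<in>pivots n V. q < k \<longrightarrow> v $ q = f q" for k
  proof (induction k)
    case 0
    then show ?case using subspaceD(3)[OF V] by auto
  next
    case (Suc k)
    then obtain v where v: "v \<in> V" "\<forall>q\<in>pivots n V. q < k \<longrightarrow> v $ q = f q" by blast
    show ?case
    proof (cases "k \<in> pivots n V")
      case True
      then obtain w where w: "w \<in> V" "leads k w" "k < n" by (auto simp: pivots_def)
      define v' where "v' = v + smul ((f k - v $ k) \<star> inverse (w $ k)) w"
      have "v' \<in> V" unfolding v'_def using v w subspaceD[OF V] by blast
      moreover have "v' $ q = f q" if q: "q \<in> pivots n V" "q < Suc k" for q
        using q v w subspaceD(2)[OF V v(1)] subspaceD(2)[OF V w(1)]
        by (cases "q = k") (auto simp: v'_def leads_def mul_assoc inverse_mul)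
      ultimately show ?thesis by blast
    next
      case False
      then show ?thesis using v by (metis less_SucE)
    qed
  qed
  from this[of n] show ?thesis by (auto simp: pivots_def)
qed

text \<open>The difference lies in \<open>V\<close>, so its first nonzero entry would be at a pivot,
  where it vanishes. With \<open>ex_values_at_pivots\<close> this makes the entries at the pivots
  free coordinates on \<open>V\<close>.\<close>

lemma eq_if_eq_at_pivots:
  assumes V: "subspace n V" and v: "v \<in> V" and w: "w \<in> V"
    and eq: "\<And>q. q \<in> pivots n V \<Longrightarrow> v $ q = w $ q"
  shows "v = w"
proof (rule ccontr)
  assume "v \<noteq> w"
  have c: "v \<in> carrier_vec n" "w \<in> carrier_vec n" using v w subspaceD(1)[OF V] by auto
  have "v - w \<noteq> 0\<^sub>v n"
  proof
    assume z: "v - w = 0\<^sub>v n"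
    have "v $ q = w $ q" if "q < n" for q
      using c that arg_cong[OF z, of "\<lambda>x. x $ q"] by auto
    then show False using \<open>v \<noteq> w\<close> c by (metis carrier_vecD eq_vecI)
  qed
  then obtain q where q: "q < n" "leads q (v - w)" using ex_leads c by (metis minus_carrier_vec)
  then have "q \<in> pivots n V" using subspace_diff[OF V v w] by (auto simp: pivots_def)
  then show False using q c eq by (auto simp: leads_def)
qed

lemma subspace_adjoin:
  assumes V: "subspace n V" and x: "x \<in> carrier_vec n"
  shows "subspace n (adjoin V x)"
  unfolding subspace_def
proof (intro conjI ballI allI)
  show "adjoin V x \<subseteq> carrier_vec n" using subspaceD(1)[OF V] x by (auto simp: adjoin_def)
  have "0\<^sub>v n = 0\<^sub>v n + smul 0 x" using x by (intro eq_vecI) auto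
  then show "0\<^sub>v n \<in> adjoin V x" using subspaceD(3)[OF V] unfolding adjoin_def by blast
next
  fix v w assume "v \<in> adjoin V x" "w \<in> adjoin V x"
  then obtain v' w' c d where *: "v' \<in> V" "w' \<in> V" "v = v' + smul c x" "w = w' + smul d x"
    unfolding adjoin_def by blast
  have "v + w = (v' + w') + smul (c + d) x"
    using * x subspaceD(2)[OF V] by (intro eq_vecI) (auto simp: add_mul algebra_simps)
  then show "v + w \<in> adjoin V x" using * subspaceD(4)[OF V] unfolding adjoin_def by blast
next
  fix c v assume "v \<in> adjoin V x"
  then obtain v' d where *: "v' \<in> V" "v = v' + smul d x" unfolding adjoin_def by blast
  have "smul c v = smul c v' + smul (c \<star> d) x"
    using * x subspaceD(2)[OF V] by (intro eq_vecI) (auto simp: mul_add mul_assoc)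
  then show "smul c v \<in> adjoin V x" using * subspaceD(5)[OF V] unfolding adjoin_def by blast
qed

lemma adjoin_superset:
  assumes V: "subspace n V" and x: "x \<in> carrier_vec n"
  shows "V \<subseteq> adjoin V x" "x \<in> adjoin V x"
proof -
  have "v = v + smul 0 x" if "v \<in> V" for v
    using that subspaceD(2)[OF V] x by (intro eq_vecI) auto
  then show "V \<subseteq> adjoin V x" unfolding adjoin_def by blast
  have "x = 0\<^sub>v n + smul 1 x" using x by (intro eq_vecI) auto
  then show "x \<in> adjoin V x" using subspaceD(3)[OF V] unfolding adjoin_def by blast
qed

lemma adjoin_least:
  assumes "subspace n U" "V \<subseteq> U" "x \<in> U"
  shows "adjoin V x \<subseteq> U"
  using assms subspaceD[OF assms(1)] by (auto simp: adjoin_def)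

lemma adjoin_absorb:
  assumes "subspace n V" "x \<in> V"
  shows "adjoin V x = V"
  using adjoin_least[OF assms(1) _ assms(2)] adjoin_superset[OF assms(1)] subspaceD(1)[OF assms(1)]
    assms(2) by blast

text \<open>Subtract from \<open>x\<close> the vector of \<open>V\<close> that agrees with it at all
  pivots. The remainder \<open>y\<close> is nonzero and vanishes at the pivots, so its leading
  position is the one new pivot.\<close>

lemma pdim_adjoin:
  assumes V: "subspace n V" and x: "x \<in> carrier_vec n" "x \<notin> V"
  shows "pdim n (adjoin V x) = Suc (pdim n V)"
proof -
  let ?P = "pivots n V"
  obtain u where u: "u \<in> V" "\<forall>q\<in>?P. u $ q = x $ q"
    using ex_values_at_pivots[OF V, of "\<lambda>q. x $ q"] by blast
  have uc: "u \<in> carrier_vec n" using u subspaceD(1)[OF V] by blast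
  define y where "y = x - u"
  have y: "y \<in> carrier_vec n" using x uc by (auto simp: y_def)
  have xy: "x = u + y" using x uc unfolding y_def by (intro eq_vecI) auto
  have y0: "y $ q = 0" if "q \<in> ?P" for q
    using that u x uc pivots_subset[of n V] by (auto simp: y_def)
  have "y \<noteq> 0\<^sub>v n" using x u uc xy by auto
  then obtain q where q: "q < n" "leads q y" using ex_leads y by blast
  have qP: "q \<notin> ?P" using y0 q by (auto simp: leads_def)
  have W: "subspace n (adjoin V x)" using subspace_adjoin V x by blast
  have "pivots n (adjoin V x) = insert q ?P"
  proof (intro equalityI subsetI)
    fix p assume "p \<in> insert q ?P"
    moreover have "y \<in> adjoin V x"
      unfolding y_def using subspace_diff[OF W] adjoin_superset[OF V x(1)] u by blast
    ultimately show "p \<in> pivots n (adjoin V x)"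
      using q adjoin_superset(1)[OF V x(1)] by (auto simp: pivots_def)
  next
    fix p assume "p \<in> pivots n (adjoin V x)"
    then obtain w c where p: "p < n" "w \<in> V" "leads p (w + smul c x)"
      by (auto simp: pivots_def adjoin_def)
    define v where "v = w + smul c u"
    have v: "v \<in> V" using p u subspaceD[OF V] by (auto simp: v_def)
    then have vc: "v \<in> carrier_vec n" using subspaceD(1)[OF V] by blast
    \<comment> \<open>Trading \<open>x\<close> for \<open>y\<close> separates a part in
      \<open>V\<close> from a part that vanishes at the pivots of \<open>V\<close>.\<close>
    have eq: "w + smul c x = v + smul c y"
      using p u y uc x subspaceD(2)[OF V] unfolding xy v_def
      by (intro eq_vecI) (auto simp: mul_add algebra_simps)
    have ix: "(v + smul c y) $ i = v $ i + c \<star> y $ i" if "i < n" for i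
      using that vc y by auto
    show "p \<in> insert q ?P"
    \<comment> \<open>If \<open>v\<close> vanishes up to \<open>p\<close>, the leading entry comes
      from \<open>y\<close>. Otherwise the leading entry of \<open>v\<close> sits at a pivot, where
      \<open>y\<close> cannot cancel it, so this pivot is \<open>p\<close>.\<close>
    proof (cases "\<forall>i\<le>p. v $ i = 0")
      case True
      then have "leads p y" using p ix unfolding eq leads_def by auto
      then show ?thesis using q leads_unique by blast
    next
      case False
      then obtain i where i: "i \<le> p" "v $ i \<noteq> 0" by blast
      then have "v \<noteq> 0\<^sub>v n" using p by auto
      then obtain i' where i': "i' < n" "leads i' v" using ex_leads vc by blast
      then have "i' \<le> i" using i unfolding leads_def by (metis linorder_not_less)
      have "i' \<in> ?P" using i' v by (auto simp: pivots_def)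
      then have "(v + smul c y) $ i' \<noteq> 0" using i' y0 ix by (auto simp: leads_def)
      then have "i' = p" using p(3) \<open>i' \<le> i\<close> i unfolding eq leads_def
        by (meson le_neq_implies_less order.trans)
      then show ?thesis using \<open>i' \<in> ?P\<close> by blast
    qed
  qed
  then show ?thesis using qP by (simp add: pdim_def)
qed

text \<open>A vector of \<open>V\<close> outside \<open>W\<close> could be adjoined to
  \<open>W\<close> within \<open>V\<close>, which would push the dimension beyond that of
  \<open>V\<close>.\<close>

lemma subspace_eqI:
  assumes V: "subspace n V" and W: "subspace n W" "W \<subseteq> V" and le: "pdim n V \<le> pdim n W"
  shows "V = W"
proof (rule ccontr)
  assume "V \<noteq> W"
  then obtain x where x: "x \<in> V" "x \<notin> W" using W by blast
  then have xc: "x \<in> carrier_vec n" using subspaceD(1)[OF V] by blast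
  have "Suc (pdim n W) \<le> pdim n V"
    using pdim_adjoin[OF W(1) xc x(2)] pdim_mono[OF adjoin_least[OF V W(2) x(1)]] by metis
  then show False using le by simp
qed

section \<open>Enlarging a subspace by a family of vectors\<close>

lemma extend_empty:
  assumes "W \<subseteq> carrier_vec n"
  shows "extend n W {} u = W"
proof -
  have "w + lc n {} c u = w" if "w \<in> W" for w c
    using that assms by (intro eq_vecI) auto
  then show ?thesis unfolding extend_def by force
qed

text \<open>Reduces finite families to single vectors, for which \<open>pdim_adjoin\<close> counts
  the dimension.\<close>

lemma extend_insert:
  assumes W: "W \<subseteq> carrier_vec n" and I: "finite I" "k \<notin> I" and u: "u k \<in> carrier_vec n"
  shows "extend n W (insert k I) u = adjoin (extend n W I u) (u k)"
proof (intro equalityI subsetI)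
  fix x assume "x \<in> extend n W (insert k I) u"
  then obtain w c where x: "w \<in> W" "x = w + lc n (insert k I) c u" unfolding extend_def by blast
  then have "x = (w + lc n I c u) + smul (c k) (u k)"
    using W u by (auto simp: lc_insert[of I k u n c, OF I u])
  then show "x \<in> adjoin (extend n W I u) (u k)" using x unfolding adjoin_def extend_def by blast
next
  fix x assume "x \<in> adjoin (extend n W I u) (u k)"
  then obtain w c d where x: "w \<in> W" "x = (w + lc n I c u) + smul d (u k)"
    unfolding extend_def adjoin_def by blast
  have "lc n (insert k I) (c(k := d)) u = lc n I c u + smul d (u k)"
    using lc_insert[of I k u n "c(k := d)", OF I u] I lc_cong[of I "c(k := d)" c u u n] by fastforce
  moreover have "w \<in> carrier_vec n" using x W by blast
  ultimately have "x = w + lc n (insert k I) (c(k := d)) u"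
    using x u by (metis assoc_add_vec lc_carrier smul_carrier)
  then show "x \<in> extend n W (insert k I) u" using x unfolding extend_def by blast
qed

lemma extend_cong:
  assumes "\<And>p. p \<in> I \<Longrightarrow> u p = u' p"
  shows "extend n W I u = extend n W I u'"
proof -
  have "lc n I c u = lc n I c u'" for c using assms by (intro lc_cong) auto
  then show ?thesis unfolding extend_def by simp
qed

text \<open>One induction for all four facts, since bounding the dimension after the next vector
  requires that the span so far is a subspace.\<close>

lemma subspace_extend:
  assumes W: "subspace n W" and I: "finite I" and u: "\<And>p. p \<in> I \<Longrightarrow> u p \<in> carrier_vec n"
  shows "subspace n (extend n W I u)" and "pdim n (extend n W I u) \<le> pdim n W + card I"
    and "W \<subseteq> extend n W I u" and "\<And>p. p \<in> I \<Longrightarrow> u p \<in> extend n W I u"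
proof -
  have Wc: "W \<subseteq> carrier_vec n" using W by (simp add: subspace_def)
  have "subspace n (extend n W I u) \<and> pdim n (extend n W I u) \<le> pdim n W + card I \<and>
    W \<subseteq> extend n W I u \<and> (\<forall>p\<in>I. u p \<in> extend n W I u)"
    using I u
  proof (induction I)
    case empty
    then show ?case using W by (simp add: extend_empty[OF Wc])
  next
    case (insert k I)
    let ?E = "extend n W I u"
    have E: "subspace n ?E" "pdim n ?E \<le> pdim n W + card I" "W \<subseteq> ?E" "\<forall>p\<in>I. u p \<in> ?E"
      using insert by auto
    have k: "u k \<in> carrier_vec n" using insert.prems by simp
    have "pdim n (adjoin ?E (u k)) \<le> Suc (pdim n ?E)"
      using pdim_adjoin[OF E(1) k] adjoin_absorb[OF E(1)] by (cases "u k \<in> ?E") auto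
    then show ?case
      using extend_insert[where u=u, OF Wc insert.hyps k] insert.hyps E subspace_adjoin[OF E(1) k]
        adjoin_superset[OF E(1) k] by auto
  qed
  then show "subspace n (extend n W I u)" "pdim n (extend n W I u) \<le> pdim n W + card I"
    "W \<subseteq> extend n W I u" "\<And>p. p \<in> I \<Longrightarrow> u p \<in> extend n W I u"
    by auto
qed

lemma extend_least:
  assumes "subspace n U" "W \<subseteq> U" "finite I" "\<And>p. p \<in> I \<Longrightarrow> u p \<in> U"
  shows "extend n W I u \<subseteq> U"
proof -
  have "lc n I c u \<in> U" for c using subspace_lc assms by blast
  then show ?thesis using assms subspaceD(4)[OF assms(1)] by (auto simp: extend_def)
qed

text \<open>Both sides are the least subspace that contains \<open>W\<close> and all the vectors;
  the two index sets may overlap.\<close>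

lemma extend_extend:
  assumes W: "subspace n W" and fin: "finite I" "finite I'"
    and u: "\<And>p. p \<in> I \<union> I' \<Longrightarrow> u p \<in> carrier_vec n"
  shows "extend n (extend n W I u) I' u = extend n W (I \<union> I') u"
proof -
  have E: "subspace n (extend n W I u)" using subspace_extend(1)[OF W fin(1)] u by blast
  have F: "subspace n (extend n W (I \<union> I') u)"
    using subspace_extend(1)[OF W, of "I \<union> I'"] u fin by blast
  have G: "subspace n (extend n (extend n W I u) I' u)"
    using subspace_extend(1)[OF E fin(2)] u by blast
  have e: "W \<subseteq> extend n W I u" "\<And>p. p \<in> I \<Longrightarrow> u p \<in> extend n W I u"
    using subspace_extend(3,4)[OF W fin(1)] u by blast+
  have f: "W \<subseteq> extend n W (I \<union> I') u" "\<And>p. p \<in> I \<union> I' \<Longrightarrow> u p \<in> extend n W (I \<union> I') u"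
    using subspace_extend(3,4)[OF W, of "I \<union> I'"] u fin by blast+
  have g: "extend n W I u \<subseteq> extend n (extend n W I u) I' u"
    "\<And>p. p \<in> I' \<Longrightarrow> u p \<in> extend n (extend n W I u) I' u"
    using subspace_extend(3,4)[OF E fin(2)] u by blast+
  show ?thesis
  proof
    show "extend n (extend n W I u) I' u \<subseteq> extend n W (I \<union> I') u"
      using f fin by (intro extend_least[OF F]) auto
    show "extend n W (I \<union> I') u \<subseteq> extend n (extend n W I u) I' u"
      using e g fin by (intro extend_least[OF G]) auto
  qed
qed

text \<open>Greedy choice: each index takes a vector of \<open>V\<close> outside the current span
  while there is one, and the zero vector afterwards. The dimension still missing thus never exceeds
  the number of indices left.\<close>

lemma ex_extend:
  assumes V: "subspace n V" and I: "finite I" and W: "subspace n W" "W \<subseteq> V"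
    and le: "pdim n V \<le> pdim n W + card I"
  shows "\<exists>u. (\<forall>p. u p \<in> V) \<and> extend n W I u = V"
  using I W le
proof (induction I arbitrary: W)
  case empty
  then have "V = W" using subspace_eqI[OF V] by simp
  moreover have "W \<subseteq> carrier_vec n" using empty by (simp add: subspace_def)
  ultimately have "extend n W {} (\<lambda>_. 0\<^sub>v n) = V" by (simp add: extend_empty)
  then show ?case using subspaceD(3)[OF V] by (intro exI[of _ "\<lambda>_. 0\<^sub>v n"]) auto
next
  case (insert k I)
  obtain x where x: "x \<in> V" "pdim n V \<le> pdim n (adjoin W x) + card I"
  proof (cases "V = W")
    case True
    then show thesis
      \<comment> \<open>Nothing is missing any more: the index is spent on the zero vector.\<close>
      using that[of "0\<^sub>v n"] subspaceD(3)[OF V] adjoin_absorb[OF V, of "0\<^sub>v n"] by auto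
  next
    case False
    then obtain x where "x \<in> V" "x \<notin> W" using insert.prems by blast
    then show thesis
      using that[of x] pdim_adjoin[OF insert.prems(1)] subspaceD(1)[OF V] insert by auto
  qed
  have xc: "x \<in> carrier_vec n" using x subspaceD(1)[OF V] by blast
  have W: "W \<subseteq> carrier_vec n" using insert.prems by (simp add: subspace_def)
  obtain u where u: "\<forall>p. u p \<in> V" "extend n (adjoin W x) I u = V"
    using insert.IH[OF subspace_adjoin[OF insert.prems(1) xc]
        adjoin_least[OF V insert.prems(2) x(1)] x(2)] by blast
  define u' where "u' = u(k := x)"
  have u': "u' p \<in> V" for p using u x by (auto simp: u'_def)
  then have u'c: "u' p \<in> carrier_vec n" for p using subspaceD(1)[OF V] by blast
  have "extend n W {k} u' = adjoin W x"
    using extend_insert[of W n "{}" k u'] xc W by (simp add: u'_def extend_empty)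
  moreover have "extend n (adjoin W x) I u' = V"
    using u(2) extend_cong[of I u' u n "adjoin W x"] insert.hyps by (metis fun_upd_other u'_def)
  ultimately have "extend n W (insert k I) u' = V"
    using extend_extend[OF insert.prems(1), of "{k}" I u'] u'c insert.hyps by simp
  then show ?case using u' by blast
qed

end

section \<open>Reduced echelon matrices\<close>

text \<open>\<open>pivot_fun\<close> compares consecutive rows only and repeats the value
  \<open>n\<close> on zero rows. A value below \<open>n\<close> at \<open>j\<close> rules out zero
  rows before \<open>j\<close>.\<close>

lemma pivot_fun_strict_mono:
  assumes p: "pivot_fun R f n" and "i < j" "j < dim_row R" "f j < n"
  shows "f i < f j"
  using assms(2-)
proof (induction j)
  case (Suc j)
  then have "f j < f (Suc j)"
    using pivot_funD(3)[OF refl p, of j] by auto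
  then show ?case using Suc by (cases "i = j") auto
qed simp

context twisted_mult
begin

section \<open>Matrix products and row spaces\<close>

lemma extend_zero: "extend n {0\<^sub>v n} I u = range (\<lambda>c. lc n I c u)"
proof -
  have "0\<^sub>v n + lc n I c u = lc n I c u" for c by (intro eq_vecI) auto
  then show ?thesis unfolding extend_def by auto
qed

text \<open>For the flipped multiplication this is the matrix product over the opposite ring;
  \<open>right_mmul\<close> translates it back.\<close>

definition mmul :: "'a mat \<Rightarrow> 'a mat \<Rightarrow> 'a mat" where
  "mmul T A = mat (dim_row T) (dim_col A)
     (\<lambda>(i, j). \<Sum>k<dim_row A. T $$ (i, k) \<star> A $$ (k, j))"

definition rowsp :: "'a mat \<Rightarrow> 'a vec set" where
  "rowsp A = extend (dim_col A) {0\<^sub>v (dim_col A)} {..<dim_row A} (row A)"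

lemma mmul_carrier [simp]:
  "T \<in> carrier_mat m k \<Longrightarrow> A \<in> carrier_mat k' n \<Longrightarrow> mmul T A \<in> carrier_mat m n"
  by (auto simp: mmul_def)

lemma row_mmul:
  assumes "T \<in> carrier_mat m k" "A \<in> carrier_mat k n" "i < m"
  shows "row (mmul T A) i = lc n {..<k} (\<lambda>j. T $$ (i, j)) (row A)"
  using assms by (intro eq_vecI) (auto simp: mmul_def)

lemma mem_rowsp:
  assumes "A \<in> carrier_mat m n"
  shows "v \<in> rowsp A \<longleftrightarrow> (\<exists>c. v = lc n {..<m} c (row A))"
  using assms unfolding rowsp_def by (auto simp: extend_zero)

lemma subspace_rowsp:
  assumes "A \<in> carrier_mat m n"
  shows "subspace n (rowsp A)" and "\<And>i. i < m \<Longrightarrow> row A i \<in> rowsp A"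
proof -
  have u: "row A p \<in> carrier_vec n" for p using assms by auto
  show "subspace n (rowsp A)" "\<And>i. i < m \<Longrightarrow> row A i \<in> rowsp A"
    using subspace_extend(1,4)[of n "{0\<^sub>v n}" "{..<m}" "row A", OF subspace_zero _ u] assms
    unfolding rowsp_def by auto
qed

lemma row_mmul_in_rowsp:
  assumes "T \<in> carrier_mat m k" "A \<in> carrier_mat k n" "i < m"
  shows "row (mmul T A) i \<in> rowsp A"
  unfolding row_mmul[OF assms] mem_rowsp[OF assms(2)] by blast

text \<open>Each row of a product combines the rows of \<open>A\<close> with coefficients from the
  same row of \<open>T\<close>, so \<open>T\<close> can be assembled row by row.\<close>

lemma mmul_image:
  assumes A: "A \<in> carrier_mat k n"
  shows "{mmul T A | T. T \<in> carrier_mat m k} =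
    {X \<in> carrier_mat m n. \<forall>i<m. row X i \<in> rowsp A}" (is "?L = ?R")
proof (intro equalityI subsetI)
  fix X assume "X \<in> ?L"
  then obtain T where "T \<in> carrier_mat m k" "X = mmul T A" by blast
  then show "X \<in> ?R" using A row_mmul_in_rowsp by simp
next
  fix X assume X: "X \<in> ?R"
  then have "\<forall>i. \<exists>c. i < m \<longrightarrow> row X i = lc n {..<k} c (row A)" using mem_rowsp[OF A] by blast
  then obtain c where c: "\<And>i. i < m \<Longrightarrow> row X i = lc n {..<k} (c i) (row A)" by metis
  define T where "T = mat m k (\<lambda>(i, j). c i j)"
  have T: "T \<in> carrier_mat m k" by (simp add: T_def)
  have "X = mmul T A"
  proof (intro eq_rowI)
    fix i assume "i < dim_row (mmul T A)"
    then have i: "i < m" using T by (simp add: mmul_def)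
    then show "row X i = row (mmul T A) i"
      unfolding row_mmul[OF T A i] c[OF i] by (intro lc_cong) (auto simp: T_def)
  qed (use X T A in \<open>auto simp: mmul_def\<close>)
  then show "X \<in> ?L" using T by blast
qed

text \<open>The pivot column \<open>f i\<close> is a unit vector, so the entry there reads off the
  coefficient of row \<open>i\<close>.\<close>

lemma lc_at_pivot:
  assumes R: "R \<in> carrier_mat m n" and p: "pivot_fun R f n" and i: "i < m" "f i < n"
  shows "lc n {..<m} c (row R) $ f i = c i"
proof -
  have d: "dim_row R = m" "dim_col R = n" using R by auto
  have "lc n {..<m} c (row R) $ f i = (\<Sum>k<m. c k \<star> R $$ (k, f i))"
    using i d by simp
  also have "\<dots> = (\<Sum>k<m. if k = i then c i else 0)"
    using pivot_funD(4,5)[OF d(1) p] i by (intro sum.cong) auto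
  finally show ?thesis using i by simp
qed

lemma pivots_rowsp:
  assumes R: "R \<in> carrier_mat m n" and p: "pivot_fun R f n"
  shows "pivots n (rowsp R) = f ` {i. i < m \<and> f i < n}"
proof -
  have d: "dim_row R = m" "dim_col R = n" using R by auto
  note pD = pivot_funD[OF d(1) p]
  show ?thesis
  proof (intro equalityI subsetI)
    fix q assume "q \<in> pivots n (rowsp R)"
    then obtain c where q: "q < n" "leads q (lc n {..<m} c (row R))"
      by (auto simp: pivots_def mem_rowsp[OF R])
    then have "(\<Sum>k<m. c k \<star> R $$ (k, q)) \<noteq> 0" using d by (simp add: leads_def)
    \<comment> \<open>Some row \<open>k\<close> contributes to the leading entry. Its pivot is at
      most \<open>q\<close>, and the combination is nonzero there by \<open>lc_at_pivot\<close>;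
      being leading, \<open>q\<close> is that pivot.\<close>
    then obtain k where "k \<in> {..<m}" "c k \<star> R $$ (k, q) \<noteq> 0"
      by (rule sum.not_neutral_contains_not_neutral)
    then have k: "k < m" "c k \<noteq> 0" "R $$ (k, q) \<noteq> 0" by auto
    then have "f k \<le> q" using pD(2) by (metis linorder_not_less)
    moreover have "lc n {..<m} c (row R) $ f k \<noteq> 0"
      using lc_at_pivot[OF R p k(1)] k q \<open>f k \<le> q\<close> by simp
    ultimately have "f k = q" using q unfolding leads_def by (metis le_neq_implies_less)
    then show "q \<in> f ` {i. i < m \<and> f i < n}" using k q by blast
  next
    fix q assume "q \<in> f ` {i. i < m \<and> f i < n}"
    then obtain i where i: "i < m" "f i < n" "q = f i" by blast
    then have "leads q (row R i)" using pD(2,4) d by (auto simp: leads_def)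
    then show "q \<in> pivots n (rowsp R)"
      using i subspace_rowsp(2)[OF R] by (auto simp: pivots_def)
  qed
qed

section \<open>Uniqueness and existence of echelon matrices with a given row space\<close>

text \<open>Both matrices have the same set of pivot columns. If \<open>f i\<close> were smaller
  than \<open>f' i\<close>, it would have to occur as \<open>f' j\<close> with \<open>j < i\<close>,
  but there \<open>f' j = f j\<close>, which differs from \<open>f i\<close>.\<close>

lemma pivot_fun_le:
  assumes "R \<in> carrier_mat m n" "pivot_fun R f n" "R' \<in> carrier_mat m n" "pivot_fun R' f' n"
    and eq: "rowsp R = rowsp R'" and i: "i < m" and less: "\<And>j. j < i \<Longrightarrow> f j = f' j"
  shows "f' i \<le> f i"
proof (rule ccontr)
  assume "\<not> f' i \<le> f i"
  then have lt: "f i < f' i" by simp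
  also have "f' i \<le> n" using pivot_funD(1)[OF _ assms(4) i] assms(3) by auto
  finally have "f i \<in> f ` {i. i < m \<and> f i < n}" using i by blast
  then have "f i \<in> f' ` {i. i < m \<and> f' i < n}"
    using pivots_rowsp[OF assms(1,2)] pivots_rowsp[OF assms(3,4)] eq by simp
  then obtain j where j: "j < m" "f' j < n" "f i = f' j" by blast
  then have "j \<noteq> i" using lt by auto
  moreover have "\<not> i < j"
    using pivot_fun_strict_mono[OF assms(4), of i j] j lt assms(3) by auto
  ultimately have "j < i" by simp
  then have "f j = f i" using less j by simp
  then show False
    using pivot_fun_strict_mono[OF assms(2) \<open>j < i\<close>] i assms(1) \<open>f i < f' i\<close> j by auto
qed

text \<open>The row space determines the pivot columns, and their increasing order determines the
  pivot function. A nonzero row is then the vector of the row space with unit coordinates at the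
  pivots.\<close>

lemma row_echelon_unique:
  assumes R: "R \<in> carrier_mat m n" "pivot_fun R f n"
    and R': "R' \<in> carrier_mat m n" "pivot_fun R' f' n" and eq: "rowsp R = rowsp R'"
  shows "R = R'"
proof (rule eq_rowI)
  have d: "dim_row R = m" "dim_col R = n" "dim_row R' = m" "dim_col R' = n" using R R' by auto
  have ff: "i < m \<Longrightarrow> f i = f' i" for i
  proof (induction i rule: less_induct)
    case (less i)
    then have "\<And>j. j < i \<Longrightarrow> f j = f' j" by simp
    then show ?case
      using pivot_fun_le[OF R R' eq less.prems] pivot_fun_le[OF R' R eq[symmetric] less.prems]
      by (simp add: le_antisym)
  qed
  fix i assume "i < dim_row R'"
  then have i: "i < m" using R' by simp
  show "row R i = row R' i"
  proof (cases "f i < n")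
    case True
    show ?thesis
    proof (rule eq_if_eq_at_pivots[OF subspace_rowsp(1)[OF R(1)]])
      show "row R i \<in> rowsp R" using subspace_rowsp(2)[OF R(1) i] .
      show "row R' i \<in> rowsp R" using subspace_rowsp(2)[OF R'(1) i] eq by simp
      fix q assume "q \<in> pivots n (rowsp R)"
      then obtain j where j: "j < m" "f j < n" "q = f j" using pivots_rowsp[OF R] by blast
      then show "row R i $ q = row R' i $ q"
        using pivot_funD(4,5)[OF d(1) R(2) j(1)] pivot_funD(4,5)[OF d(3) R'(2) j(1)] i d ff
        by (cases "j = i") auto
    qed
  next
    case False
    then have "f i = n" using pivot_funD(1)[OF d(1) R(2) i] by simp
    then show ?thesis
      using pivot_funD(2)[OF d(1) R(2) i] pivot_funD(2)[OF d(3) R'(2) i] ff[OF i] i d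
      by (intro eq_vecI) auto
  qed
qed (use R R' in auto)

text \<open>The nonzero rows are the vectors of \<open>V\<close> with unit coordinates at the
  pivots, in increasing order of the pivots; zero rows fill up the square matrix.\<close>

lemma ex_row_echelon:
  assumes V: "subspace n V"
  shows "\<exists>R f. R \<in> carrier_mat n n \<and> pivot_fun R f n \<and> rowsp R = V"
proof -
  let ?P = "pivots n V"
  define ps where "ps = sorted_list_of_set ?P"
  have ps: "set ps = ?P" "sorted_wrt (<) ps" "distinct ps" by (simp_all add: ps_def)
  have len: "length ps \<le> n" using pdim_le[of n V] by (simp add: ps_def pdim_def)
  have "\<exists>v. i < length ps \<longrightarrow> v \<in> V \<and> (\<forall>q\<in>?P. v $ q = (if q = ps ! i then 1 else 0))" for i
    using ex_values_at_pivots[OF V, of "\<lambda>q. if q = ps ! i then 1 else 0"] by blast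
  then obtain b where b: "\<And>i. i < length ps \<Longrightarrow> b i \<in> V"
    "\<And>i q. i < length ps \<Longrightarrow> q \<in> ?P \<Longrightarrow> b i $ q = (if q = ps ! i then 1 else 0)" by metis
  define R where "R = mat n n (\<lambda>(i, q). if i < length ps then b i $ q else 0)"
  \<comment> \<open>The value \<open>n\<close> is the mark of a zero row in
    \<open>pivot_fun\<close>.\<close>
  define f where "f i = (if i < length ps then ps ! i else n)" for i
  have R: "R \<in> carrier_mat n n" by (simp add: R_def)
  have psP: "ps ! i \<in> ?P" if "i < length ps" for i using that ps(1) nth_mem by blast
  have psn: "ps ! i < n" if "i < length ps" for i using psP[OF that] pivots_subset[of n V] by auto
  \<comment> \<open>The leading position of \<open>b i\<close> is a pivot, and \<open>ps ! i\<close>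
    is the only pivot at which \<open>b i\<close> is nonzero.\<close>
  have low: "b i $ q = 0" if i: "i < length ps" and q: "q < ps ! i" for i q
  proof -
    have "b i $ (ps ! i) = 1" using b psP i by auto
    moreover have bc: "b i \<in> carrier_vec n" using subspaceD(1)[OF V] b i by blast
    ultimately have "b i \<noteq> 0\<^sub>v n" using psn[OF i] by auto
    then obtain q' where q': "q' < n" "leads q' (b i)" using ex_leads[OF bc] by blast
    then have "q' \<in> ?P" using b i by (auto simp: pivots_def)
    then have "q' = ps ! i" using b(2)[OF i] q' by (metis leads_def)
    then show ?thesis using q' q by (simp add: leads_def)
  qed
  have pf: "pivot_fun R f n"
  proof (rule pivot_funI)
    show "dim_row R = n" by (simp add: R_def)
    show "f i \<le> n" if "i < n" for i using psn[of i] by (auto simp: f_def)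
    show "R $$ (i, j) = 0" if "i < n" "j < f i" for i j
      using that low[of i j] psn[of i] by (auto simp: R_def f_def split: if_splits)
    show "f i < f (Suc i) \<or> f (Suc i) = n" if "i < n" "Suc i < n" for i
      using sorted_wrt_nth_less[OF ps(2), of i "Suc i"] by (auto simp: f_def)
    show "R $$ (i, f i) = 1" if "i < n" "f i < n" for i
      using that b(2)[of i "ps ! i"] psP[of i] by (auto simp: R_def f_def split: if_splits)
    show "R $$ (i', f i) = 0" if "i < n" "f i < n" "i' < n" "i' \<noteq> i" for i i'
    proof (cases "i' < length ps")
      case True
      moreover have "i < length ps" using that by (auto simp: f_def split: if_splits)
      ultimately show ?thesis
        using that b(2)[of i' "ps ! i"] psP[of i] nth_eq_iff_index_eq[OF ps(3)]
        by (auto simp: R_def f_def)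
    qed (use that in \<open>auto simp: R_def\<close>)
  qed
  have rows: "row R i \<in> V" if "i < n" for i
  proof (cases "i < length ps")
    case True
    then have "row R i = b i"
      using that subspaceD(2)[OF V b(1)] by (intro eq_vecI) (auto simp: R_def)
    then show ?thesis using b True by simp
  next
    case False
    then have "row R i = 0\<^sub>v n" using that by (intro eq_vecI) (auto simp: R_def)
    then show ?thesis using subspaceD(3)[OF V] by simp
  qed
  have "rowsp R = V"
  proof (intro equalityI subsetI)
    fix v assume "v \<in> rowsp R"
    then show "v \<in> V" using rows by (auto simp: mem_rowsp[OF R] intro!: subspace_lc[OF V])
  next
    fix v assume v: "v \<in> V"
    \<comment> \<open>The combination of the rows that has the same coordinates as \<open>v\<close>.
      For zero rows the coefficient \<open>v $ n\<close> is an unspecified value, which does no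
      harm.\<close>
    define w where "w = lc n {..<n} (\<lambda>i. v $ f i) (row R)"
    have "w \<in> V" unfolding w_def using rows by (intro subspace_lc[OF V]) auto
    moreover have "v $ q = w $ q" if "q \<in> ?P" for q
    proof -
      have "q \<in> set ps" using ps(1) that by simp
      then obtain i where i: "i < length ps" "q = ps ! i" by (auto simp: in_set_conv_nth)
      then have "i < n" "f i < n" "f i = q" using len psn by (auto simp: f_def)
      then show ?thesis using lc_at_pivot[OF R pf, of i "\<lambda>i. v $ f i"] by (simp add: w_def)
    qed
    ultimately have "v = w" using eq_if_eq_at_pivots[OF V v] by blast
    then show "v \<in> rowsp R" unfolding mem_rowsp[OF R] w_def by blast
  qed
  then show ?thesis using R pf by blast
qed

text \<open>The fact behind the definite descriptions of \<open>R_i\<close> and \<open>C_j\<close>.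
  Having at least one row, the matrices with all rows in \<open>V\<close> determine
  \<open>V\<close>, so the equation says that \<open>V\<close> is the row space of
  \<open>R\<close>.\<close>

lemma ex1_row_reduced_echelon:
  assumes V: "subspace n V" and k: "k \<ge> 1"
  shows "\<exists>!R. R \<in> row_reduced_echelon n \<and>
      {X \<in> carrier_mat k n. \<forall>i<k. row X i \<in> V} = {mmul X R | X. X \<in> carrier_mat k n}"
    and "\<And>R. R \<in> row_reduced_echelon n \<Longrightarrow>
      {X \<in> carrier_mat k n. \<forall>i<k. row X i \<in> V} = {mmul X R | X. X \<in> carrier_mat k n} \<Longrightarrow>
      rowsp R = V"
proof -
  define S where "S W = {X \<in> carrier_mat k n. \<forall>i<k. row X i \<in> W}" for W :: "'a vec set"
  have im: "{mmul X R | X. X \<in> carrier_mat k n} = S (rowsp R)" if "R \<in> carrier_mat n n" for R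
    using mmul_image[OF that] by (simp add: S_def)
  have sub: "W \<subseteq> W'" if W: "subspace n W" "S W \<subseteq> S W'" for W W'
  proof
    fix w assume w: "w \<in> W"
    \<comment> \<open>All rows equal \<open>w\<close>, so that membership of \<open>X\<close> tests
      membership of \<open>w\<close>.\<close>
    define X where "X = mat k n (\<lambda>(i, q). w $ q)"
    have X: "X \<in> carrier_mat k n" by (simp add: X_def)
    have row: "row X i = w" if "i < k" for i
      using that subspaceD(2)[OF W(1) w] by (intro eq_vecI) (auto simp: X_def)
    have "X \<in> S W" using X w row by (simp add: S_def)
    then have "X \<in> S W'" using W(2) by blast
    then have "row X 0 \<in> W'" using k by (simp add: S_def)
    then show "w \<in> W'" using row[of 0] k by simp
  qed
  show rsp: "rowsp R = V" if "R \<in> row_reduced_echelon n"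
    "{X \<in> carrier_mat k n. \<forall>i<k. row X i \<in> V} = {mmul X R | X. X \<in> carrier_mat k n}" for R
  proof -
    have R: "R \<in> carrier_mat n n" using that(1) by (simp add: row_reduced_echelon_def)
    have "S V = S (rowsp R)" using that(2) im[OF R] by (simp add: S_def)
    then show ?thesis using sub[OF V] sub[OF subspace_rowsp(1)[OF R]] by blast
  qed
  obtain R f where R: "R \<in> carrier_mat n n" "pivot_fun R f n" "rowsp R = V"
    using ex_row_echelon[OF V] by blast
  show "\<exists>!R. R \<in> row_reduced_echelon n \<and>
      {X \<in> carrier_mat k n. \<forall>i<k. row X i \<in> V} = {mmul X R | X. X \<in> carrier_mat k n}"
  proof (rule ex1I[of _ R])
    show "R \<in> row_reduced_echelon n \<and>
      {X \<in> carrier_mat k n. \<forall>i<k. row X i \<in> V} = {mmul X R | X. X \<in> carrier_mat k n}"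
      using R im[OF R(1)] by (auto simp: row_reduced_echelon_def row_echelon_form_def S_def)
  next
    fix R' assume R': "R' \<in> row_reduced_echelon n \<and>
      {X \<in> carrier_mat k n. \<forall>i<k. row X i \<in> V} = {mmul X R' | X. X \<in> carrier_mat k n}"
    then obtain f' where f': "R' \<in> carrier_mat n n" "pivot_fun R' f' n"
      by (auto simp: row_reduced_echelon_def row_echelon_form_def)
    have "rowsp R' = rowsp R" using rsp R' R(3) by blast
    then show "R' = R" by (rule row_echelon_unique[OF f' R(1,2)])
  qed
qed

end

section \<open>Rank\<close>

interpretation left_mult: twisted_mult "(*)"
  by unfold_locales simp

lemma left_lincomb_eq: "left_lincomb n c F = left_mult.lc n F c (\<lambda>v. v)"
  by (simp add: left_lincomb_def left_mult.lc_def)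

text \<open>A combination over a subset becomes one over all of \<open>S\<close> with zero
  coefficients for the missing vectors.\<close>

lemma left_span_eq:
  assumes "finite S"
  shows "left_span n S = left_mult.extend n {0\<^sub>v n} S (\<lambda>v. v)"
proof -
  have "left_lincomb n c F = left_lincomb n (\<lambda>v. if v \<in> F then c v else 0) S" if "F \<subseteq> S"
    for c F
    unfolding left_lincomb_def using that assms
    by (intro eq_vecI) (auto intro!: sum.mono_neutral_cong_left)
  then have "left_span n S = range (\<lambda>c. left_lincomb n c S)"
    unfolding left_span_def using assms by blast
  then show ?thesis by (simp add: left_lincomb_eq left_mult.extend_zero)
qed

lemma left_independent_subset:
  "left_independent n B \<Longrightarrow> F \<subseteq> B \<Longrightarrow> left_independent n F"
  unfolding left_independent_def by blast

text \<open>By independence every vector lies outside the span of the others, so in an insertion one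
  by one each raises the dimension by one.\<close>

lemma pdim_left_span:
  assumes "finite F" "F \<subseteq> carrier_vec n" "left_independent n F"
  shows "left_mult.pdim n (left_span n F) = card F"
  using assms
proof (induction F)
  case empty
  then show ?case by (simp add: left_span_eq left_mult.extend_zero left_mult.extend_empty
        left_mult.lc_def left_mult.pdim_def left_mult.pivots_def left_mult.leads_def)
next
  case (insert x F)
  let ?E = "left_mult.extend n {0\<^sub>v n} F (\<lambda>v. v)"
  have x: "x \<in> carrier_vec n" and F: "F \<subseteq> carrier_vec n" using insert.prems by auto
  have "x \<notin> ?E"
  proof
    assume "x \<in> ?E"
    then obtain c where c: "x = left_mult.lc n F c (\<lambda>v. v)" by (auto simp: left_mult.extend_zero)
    \<comment> \<open>A representation of \<open>x\<close> by vectors of \<open>F\<close> becomes a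
      nontrivial relation by giving \<open>x\<close> the coefficient -1.\<close>
    define c' where "c' = c(x := - 1)"
    have "(\<Sum>v\<in>insert x F. c' v * v $ q) = 0" if "q < n" for q
    proof -
      have "(\<Sum>v\<in>F. c' v * v $ q) = (\<Sum>v\<in>F. c v * v $ q)"
        using insert.hyps by (intro sum.cong) (auto simp: c'_def)
      also have "\<dots> = x $ q" using arg_cong[OF c, of "\<lambda>v. v $ q"] that by simp
      finally show ?thesis using insert.hyps by (simp add: c'_def)
    qed
    then have "left_lincomb n c' (insert x F) = 0\<^sub>v n"
      unfolding left_lincomb_def by (intro eq_vecI) auto
    then have "c' x = 0"
      using insert.prems(2) insert.hyps unfolding left_independent_def by blast
    then show False by (simp add: c'_def)
  qed
  moreover have "left_mult.subspace n ?E"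
    using F by (intro left_mult.subspace_extend left_mult.subspace_zero insert.hyps) auto
  moreover have "left_mult.extend n {0\<^sub>v n} (insert x F) (\<lambda>v. v) = left_mult.adjoin ?E x"
    using x insert.hyps by (intro left_mult.extend_insert) auto
  ultimately show ?case
    using left_mult.pdim_adjoin[OF _ x] insert.IH[OF F left_independent_subset[OF insert.prems(2)]]
      insert.hyps by (auto simp: left_span_eq)
qed

text \<open>In a relation in which \<open>x\<close> has a nonzero coefficient, multiplying by its
  inverse from the left would put \<open>x\<close> into the span of \<open>B\<close>.\<close>

lemma left_independent_insert:
  assumes B: "left_independent n B" "B \<subseteq> carrier_vec n" "finite B"
    and x: "x \<in> carrier_vec n" "x \<notin> left_span n B"
  shows "left_independent n (insert x B)"
  unfolding left_independent_def
proof (intro allI impI)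
  fix c F assume F: "finite F \<and> F \<subseteq> insert x B \<and> left_lincomb n c F = 0\<^sub>v n"
  let ?G = "F - {x}"
  have eq: "(\<Sum>v\<in>F. c v * v $ q) = 0" if "q < n" for q
  proof -
    have "left_lincomb n c F $ q = 0" using F that by simp
    then show ?thesis using that by (simp add: left_lincomb_def)
  qed
  have split: "(\<Sum>v\<in>F. c v * v $ q) = c x * x $ q + (\<Sum>v\<in>?G. c v * v $ q)" if "x \<in> F" for q
    using F that by (intro sum.remove) auto
  have c0: "c x = 0" if "x \<in> F"
  proof (rule ccontr)
    assume cx: "c x \<noteq> 0"
    have "x $ q = (\<Sum>v\<in>?G. (- inverse (c x) * c v) * v $ q)" if "q < n" for q
    proof -
      have "(\<Sum>v\<in>?G. c v * v $ q) = - (c x * x $ q)"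
        using eq[OF that] split[OF \<open>x \<in> F\<close>, of q] by (simp add: eq_neg_iff_add_eq_0 add.commute)
      then have "- inverse (c x) * (\<Sum>v\<in>?G. c v * v $ q) = x $ q"
        using cx by (simp add: mult.assoc[symmetric])
      then show ?thesis by (simp add: sum_distrib_left mult.assoc sum_negf)
    qed
    then have "x = left_lincomb n (\<lambda>v. - inverse (c x) * c v) ?G"
      using x unfolding left_lincomb_def by (intro eq_vecI) auto
    then have "x \<in> left_span n B" unfolding left_span_def using F by blast
    then show False using x by blast
  qed
  have "left_lincomb n c ?G = left_lincomb n c F"
    unfolding left_lincomb_def using F c0 by (intro eq_vecI) (auto intro!: sum.mono_neutral_left)
  then have "\<forall>v\<in>?G. c v = 0"
    using left_independent_subset[OF B(1), of ?G] F unfolding left_independent_def by auto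
  then show "\<forall>v\<in>F. c v = 0" using c0 by blast
qed

text \<open>Guarantees that the choice operator in \<open>left_dim\<close> really picks a basis. A
  vector is kept only if it lies outside the span of those kept before.\<close>

lemma ex_left_basis:
  assumes "finite S" "S \<subseteq> carrier_vec n"
  shows "\<exists>B\<subseteq>S. left_independent n B \<and> left_span n B = left_span n S"
  using assms
proof (induction S)
  case empty
  show ?case by (auto simp: left_independent_def)
next
  case (insert x S)
  then obtain B where B: "B \<subseteq> S" "left_independent n B" "left_span n B = left_span n S" by auto
  have fin: "finite B" and x: "x \<in> carrier_vec n" and Bc: "B \<subseteq> carrier_vec n"
    using B(1) insert finite_subset by auto
  have ins: "left_span n (insert x F) = left_mult.adjoin (left_span n F) x"
    if "finite F" "x \<notin> F" for F
    using that x left_mult.extend_insert[of "{0\<^sub>v n}" n F x "\<lambda>v. v"] by (simp add: left_span_eq)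
  have sub: "left_mult.subspace n (left_span n B)"
    using Bc fin by (auto simp: left_span_eq intro!: left_mult.subspace_extend left_mult.subspace_zero)
  show ?case
  proof (cases "x \<in> left_span n B")
    case True
    then have "left_span n (insert x S) = left_span n S"
      using ins insert.hyps B(3) left_mult.adjoin_absorb[OF sub] by simp
    then show ?thesis using B by auto
  next
    case False
    moreover have "left_span n (insert x B) = left_span n (insert x S)"
    proof -
      have "x \<notin> B" using B(1) insert.hyps(2) by blast
      then show ?thesis using ins[OF fin] ins[OF insert.hyps] B(3) by simp
    qed
    ultimately show ?thesis
      using left_independent_insert[OF B(2) Bc fin x] B(1) by (intro exI[of _ "insert x B"]) auto
  qed
qed

text \<open>Whichever basis \<open>left_dim\<close> picks, its size is the number of leading
  positions, which does not depend on the basis.\<close>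

lemma left_dim_left_span:
  assumes S: "finite S" "S \<subseteq> carrier_vec n"
  shows "left_dim n (left_span n S) = left_mult.pdim n (left_span n S)"
proof -
  let ?V = "left_span n S"
  let ?Q = "\<lambda>B. B \<subseteq> ?V \<and> left_independent n B \<and> left_span n B = ?V"
  have sub: "left_mult.subspace n ?V" "S \<subseteq> ?V"
    using left_mult.subspace_extend[of n "{0\<^sub>v n}" S "\<lambda>v. v"] S left_mult.subspace_zero
    by (auto simp: left_span_eq)
  obtain B0 where "?Q B0" using ex_left_basis[OF S] sub by blast
  then have B: "?Q (SOME B. ?Q B)" by (rule someI[of ?Q])
  define B where "B = (SOME B. ?Q B)"
  have Q: "?Q B" using B by (simp add: B_def)
  have Bc: "B \<subseteq> carrier_vec n" using Q left_mult.subspaceD(1)[OF sub(1)] by blast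
  \<comment> \<open>The chosen basis might be infinite a priori; \<open>n + 1\<close> of its vectors
    would then span a space with more than \<open>n\<close> pivots.\<close>
  have "finite B"
  proof (rule ccontr)
    assume "infinite B"
    then obtain F where F: "finite F" "card F = Suc n" "F \<subseteq> B"
      by (metis infinite_arbitrarily_large)
    then have "Suc n = left_mult.pdim n (left_span n F)"
      using pdim_left_span[OF F(1)] Bc Q left_independent_subset by (metis subset_trans)
    then show False using left_mult.pdim_le[of n "left_span n F"] by simp
  qed
  then have "left_mult.pdim n ?V = card B" using pdim_left_span[of B n] Bc Q by auto
  then show ?thesis by (simp add: left_dim_def B_def)
qed

lemma mat_rank_eq:
  assumes A: "A \<in> carrier_mat m n"
  shows "mat_rank A = left_mult.pdim n (left_mult.rowsp A)"
proof -
  let ?S = "set (rows A)"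
  have S: "finite ?S" "?S \<subseteq> carrier_vec n" using A rows_carrier[of A] by auto
  have E: "left_mult.subspace n (left_span n ?S)" "?S \<subseteq> left_span n ?S"
    using left_mult.subspace_extend[of n "{0\<^sub>v n}" ?S "\<lambda>v. v"] S left_mult.subspace_zero
    by (auto simp: left_span_eq)
  have rows: "?S = row A ` {..<m}" using A by (auto simp: rows_def)
  have "left_span n ?S = left_mult.rowsp A"
  proof
    show "left_span n ?S \<subseteq> left_mult.rowsp A"
      unfolding left_span_eq[OF S(1)]
      using left_mult.subspace_rowsp[OF A] rows left_mult.subspaceD(3)
      by (intro left_mult.extend_least) auto
    show "left_mult.rowsp A \<subseteq> left_span n ?S"
      unfolding left_mult.rowsp_def
      using E rows A left_mult.subspaceD(3)[OF E(1)] by (intro left_mult.extend_least) auto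
  qed
  then show ?thesis using left_dim_left_span[OF S] A by (simp add: mat_rank_def left_row_space_def)
qed

text \<open>Column rank equals row rank for reduced column echelon matrices, whose rows vanish beyond the
  pivot columns and contain the unit vectors of the pivot columns.\<close>

lemma (in twisted_mult) mat_rank_transpose:
  assumes R: "R \<in> carrier_mat m n" and p: "pivot_fun R f n"
  shows "mat_rank (transpose_mat R) = pdim n (rowsp R)"
proof -
  let ?I = "{i. i < m \<and> f i < n}"
  have d: "dim_row R = m" "dim_col R = n" using R by auto
  note pD = pivot_funD[OF d(1) p]
  have RT: "transpose_mat R \<in> carrier_mat n m" using R by simp
  have "inj_on f ?I"
    using pivot_fun_strict_mono[OF p] d by (intro linorder_inj_onI') fastforce
  then have "pdim n (rowsp R) = card ?I"
    by (simp add: pdim_def pivots_rowsp[OF R p] card_image)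
  moreover have "left_mult.pivots m (left_mult.rowsp (transpose_mat R)) = ?I"
  proof (intro equalityI subsetI)
    fix i assume "i \<in> left_mult.pivots m (left_mult.rowsp (transpose_mat R))"
    then obtain c where i: "i < m"
      "left_mult.leads i (left_mult.lc m {..<n} c (row (transpose_mat R)))"
      by (auto simp: left_mult.pivots_def left_mult.mem_rowsp[OF RT])
    have "f i \<noteq> n"
    proof
      assume "f i = n"
      then have "R $$ (i, j) = 0" if "j < n" for j using pD(2) that i by simp
      then show False using i d by (simp add: left_mult.leads_def)
    qed
    then show "i \<in> ?I" using pD(1) i by (simp add: le_neq_implies_less)
  next
    fix i assume i: "i \<in> ?I"
    then have "left_mult.leads i (row (transpose_mat R) (f i))"
      using pD(4,5) d by (auto simp: left_mult.leads_def)
    then show "i \<in> left_mult.pivots m (left_mult.rowsp (transpose_mat R))"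
      using i left_mult.subspace_rowsp(2)[OF RT] by (auto simp: left_mult.pivots_def)
  qed
  ultimately show ?thesis using mat_rank_eq[OF RT] by (simp add: left_mult.pdim_def)
qed

section \<open>Generators of submodules\<close>

context twisted_mult
begin

text \<open>Blocks enter only through the function \<open>blk\<close> from indices to block numbers,
  so reversing their order is just another choice of \<open>blk\<close>.\<close>

definition tri :: "nat \<Rightarrow> (nat \<Rightarrow> nat) \<Rightarrow> 'a mat set" where
  "tri m blk = {T \<in> carrier_mat m m. \<forall>p<m. \<forall>q<m. blk q < blk p \<longrightarrow> T $$ (p, q) = 0}"

definition tail :: "nat \<Rightarrow> nat \<Rightarrow> (nat \<Rightarrow> nat) \<Rightarrow> 'a mat \<Rightarrow> nat \<Rightarrow> 'a vec set" where
  "tail m n blk A i = extend n {0\<^sub>v n} {p. p < m \<and> i \<le> blk p} (row A)"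

lemma subspace_tail:
  assumes "A \<in> carrier_mat m n"
  shows "subspace n (tail m n blk A i)"
  unfolding tail_def using assms by (intro subspace_extend subspace_zero) auto

lemma tail_Suc:
  assumes "A \<in> carrier_mat m n"
  shows "tail m n blk A i = extend n (tail m n blk A (Suc i)) {p. p < m \<and> blk p = i} (row A)"
proof -
  have eq: "{p. p < m \<and> i \<le> blk p} = {p. p < m \<and> Suc i \<le> blk p} \<union> {p. p < m \<and> blk p = i}"
    by auto
  have "row A p \<in> carrier_vec n" for p using assms by auto
  then show ?thesis unfolding tail_def eq
    by (intro extend_extend[symmetric] subspace_zero) simp_all
qed

text \<open>Row \<open>p\<close> of \<open>T\<close> is free on the columns of block
  \<open>blk p\<close> and later blocks and zero elsewhere, so row \<open>p\<close> of the product
  ranges over all combinations of the rows of \<open>A\<close> in those blocks.\<close>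

lemma mmul_tri_image:
  assumes A: "A \<in> carrier_mat m n"
  shows "{mmul T A | T. T \<in> tri m blk} =
    {X \<in> carrier_mat m n. \<forall>p<m. row X p \<in> tail m n blk A (blk p)}" (is "?L = ?R")
proof (intro equalityI subsetI)
  let ?I = "\<lambda>p. {q. q < m \<and> blk p \<le> blk q}"
  have neutral: "lc n {..<m} c (row A) = lc n (?I p) c (row A)"
    if z: "\<And>q. q < m \<Longrightarrow> blk q < blk p \<Longrightarrow> c q = 0" for c p
  proof -
    have "(\<Sum>q<m. c q \<star> row A q $ i) = (\<Sum>q\<in>?I p. c q \<star> row A q $ i)" for i
      using z by (intro sum.mono_neutral_right) (auto, metis not_le)
    then show ?thesis by (simp add: lc_def)
  qed
  {
    fix X assume "X \<in> ?L"
    then obtain T where T: "T \<in> carrier_mat m m" "T \<in> tri m blk" "X = mmul T A"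
      by (auto simp: tri_def)
    have "row X p = lc n (?I p) (\<lambda>q. T $$ (p, q)) (row A)" if "p < m" for p
      unfolding T(3) row_mmul[OF T(1) A that] using T(2) that
      by (intro neutral) (simp add: tri_def)
    then show "X \<in> ?R" using T A by (auto simp: tail_def extend_zero)
  next
    fix X assume X: "X \<in> ?R"
    then have "\<exists>c. p < m \<longrightarrow> row X p = lc n (?I p) c (row A)" for p
      by (fastforce simp: tail_def extend_zero)
    then obtain c where c: "\<And>p. p < m \<Longrightarrow> row X p = lc n (?I p) (c p) (row A)" by metis
    define T where "T = mat m m (\<lambda>(p, q). if blk p \<le> blk q then c p q else 0)"
    have T: "T \<in> carrier_mat m m" by (simp add: T_def)
    have "X = mmul T A"
    proof (intro eq_rowI)
      fix p assume "p < dim_row (mmul T A)"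
      then have p: "p < m" using T by (simp add: mmul_def)
      have "row (mmul T A) p = lc n (?I p) (\<lambda>q. T $$ (p, q)) (row A)"
        unfolding row_mmul[OF T A p] using p by (intro neutral) (simp add: T_def)
      also have "\<dots> = row X p"
        unfolding c[OF p] using p by (intro lc_cong) (auto simp: T_def)
      finally show "row X p = row (mmul T A) p" by simp
    qed (use X T A in \<open>auto simp: mmul_def\<close>)
    moreover have "T \<in> tri m blk" by (simp add: tri_def T_def)
    ultimately show "X \<in> ?L" by blast
  }
qed

end

section \<open>A submodule and its layers\<close>

text \<open>Positivity of the block sizes appears as \<open>blk_surj\<close>. Right submodules are
  instances with transposed matrices, whose blocks are numbered from the last to the first.\<close>

locale nest_submodule = twisted_mult mul
  for mul :: "'a::division_ring \<Rightarrow> 'a \<Rightarrow> 'a" (infixl "\<star>" 70) +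
  fixes m n r :: nat and blk :: "nat \<Rightarrow> nat" and J :: "'a mat set"
  assumes blk_le: "p < m \<Longrightarrow> blk p \<le> r"
    and blk_ge: "p < m \<Longrightarrow> 1 \<le> blk p"
    and blk_surj: "1 \<le> i \<Longrightarrow> i \<le> r \<Longrightarrow> \<exists>p<m. blk p = i"
    and J_carrier: "J \<subseteq> carrier_mat m n"
    and J_zero: "0\<^sub>m m n \<in> J"
    and J_add: "A \<in> J \<Longrightarrow> B \<in> J \<Longrightarrow> A + B \<in> J"
    and J_mul: "T \<in> tri m blk \<Longrightarrow> A \<in> J \<Longrightarrow> mmul T A \<in> J"
begin

text \<open>The row space of \<open>R\<^sub>i\<close>; the zero vector is inserted for the indices beyond \<open>r\<close>.\<close>

definition layer :: "nat \<Rightarrow> 'a vec set" where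
  "layer i = insert (0\<^sub>v n) {row A p | A p. A \<in> J \<and> p < m \<and> blk p = i}"

definition single :: "nat \<Rightarrow> 'a vec \<Rightarrow> 'a mat" where
  "single p v = mat m n (\<lambda>(i, q). if i = p then v $ q else 0)"

lemma row_single:
  assumes "v \<in> carrier_vec n" "i < m"
  shows "row (single p v) i = (if i = p then v else 0\<^sub>v n)"
  using assms by (intro eq_vecI) (auto simp: single_def)

text \<open>Multiply by the matrix with the single entry \<open>c\<close> at \<open>(p, q)\<close>,
  which is block triangular because \<open>blk p \<le> blk q\<close>. So rows can be isolated and
  moved within a block or to an earlier one.\<close>

lemma single_row_in_J:
  assumes A: "A \<in> J" and p: "p < m" "q < m" "blk p \<le> blk q"
  shows "single p (smul c (row A q)) \<in> J"
proof -
  define T where "T = mat m m (\<lambda>(i, j). if i = p \<and> j = q then c else 0)"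
  have T: "T \<in> tri m blk" using p by (auto simp: T_def tri_def)
  have d: "dim_row A = m" "dim_col A = n" using A J_carrier by auto
  have "mmul T A = single p (smul c (row A q))"
  proof (rule eq_matI)
    fix i j assume "i < dim_row (single p (smul c (row A q)))"
      "j < dim_col (single p (smul c (row A q)))"
    then have ij: "i < m" "j < n" by (auto simp: single_def)
    then have "mmul T A $$ (i, j) = (\<Sum>k<m. T $$ (i, k) \<star> A $$ (k, j))"
      using d by (simp add: mmul_def T_def)
    also have "\<dots> = (\<Sum>k<m. if k = q then (if i = p then c \<star> A $$ (q, j) else 0) else 0)"
      using ij by (intro sum.cong) (auto simp: T_def)
    finally show "mmul T A $$ (i, j) = single p (smul c (row A q)) $$ (i, j)"
      using ij p d by (simp add: single_def)
  qed (use d in \<open>auto simp: mmul_def T_def single_def\<close>)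
  then show ?thesis using J_mul[OF T A] by simp
qed

lemma smul_one: "v \<in> carrier_vec n \<Longrightarrow> smul 1 v = v"
  by (intro eq_vecI) auto

lemma single_zero: "single p (0\<^sub>v n) = 0\<^sub>m m n"
  by (intro eq_matI) (auto simp: single_def)

text \<open>Any one row index of the block suffices to test membership, since rows can be moved
  within the block.\<close>

lemma mem_layer:
  assumes p: "p < m" "blk p = i"
  shows "v \<in> layer i \<longleftrightarrow> v \<in> carrier_vec n \<and> single p v \<in> J"
proof
  assume v: "v \<in> layer i"
  show "v \<in> carrier_vec n \<and> single p v \<in> J"
  proof (cases "v = 0\<^sub>v n")
    case True
    then show ?thesis using J_zero single_zero by simp
  next
    case False
    then obtain A q where A: "A \<in> J" "q < m" "blk q = i" "v = row A q"
      using v unfolding layer_def by blast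
    then have "v \<in> carrier_vec n" using J_carrier by auto
    then show ?thesis using single_row_in_J[OF A(1) p(1) A(2), of 1] A p smul_one by simp
  qed
next
  assume v: "v \<in> carrier_vec n \<and> single p v \<in> J"
  then have "v = row (single p v) p" using row_single p by simp
  then show "v \<in> layer i" using v p unfolding layer_def by blast
qed

lemma layer_outside: "r < i \<Longrightarrow> layer i = {0\<^sub>v n}"
  using blk_le unfolding layer_def by fastforce

lemma subspace_layer:
  assumes "1 \<le> i"
  shows "subspace n (layer i)"
proof (cases "i \<le> r")
  case True
  then obtain p where p: "p < m" "blk p = i" using blk_surj assms by blast
  note mem = mem_layer[OF p]
  have "single p (v + w) = single p v + single p w"
    if "v \<in> carrier_vec n" "w \<in> carrier_vec n" for v w
    using that by (intro eq_matI) (auto simp: single_def)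
  moreover have "single p (smul c v) \<in> J" if "v \<in> layer i" for c v
    using single_row_in_J[of "single p v" p p c] that p(1) mem row_single by simp
  ultimately show ?thesis
    unfolding subspace_def using J_add by (auto simp: mem single_zero J_zero)
next
  case False
  then show ?thesis using layer_outside subspace_zero by simp
qed

text \<open>A row can be moved to the preceding block.\<close>

lemma layer_Suc_subset:
  assumes "1 \<le> i"
  shows "layer (Suc i) \<subseteq> layer i"
proof (cases "Suc i \<le> r")
  case True
  then obtain p p' where p: "p < m" "blk p = Suc i" "p' < m" "blk p' = i"
    using blk_surj assms by (meson Suc_leD le_Suc_eq)
  show ?thesis
  proof
    fix v assume "v \<in> layer (Suc i)"
    then have v: "v \<in> carrier_vec n" "single p v \<in> J" using mem_layer p by auto
    then have "single p' v \<in> J"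
      using single_row_in_J[OF v(2) p(3,1), of 1] p row_single smul_one by simp
    then show "v \<in> layer i" using v mem_layer p by simp
  qed
next
  case False
  then have "layer (Suc i) = {0\<^sub>v n}" using layer_outside by simp
  then show ?thesis using subspaceD(3)[OF subspace_layer[OF assms]] by simp
qed

text \<open>A matrix is the sum of its rows, each placed in a matrix that is zero otherwise; these
  summands belong to \<open>J\<close> by \<open>mem_layer\<close>.\<close>

lemma mem_J: "A \<in> J \<longleftrightarrow> A \<in> carrier_mat m n \<and> (\<forall>p<m. row A p \<in> layer (blk p))"
proof
  assume "A \<in> J"
  then show "A \<in> carrier_mat m n \<and> (\<forall>p<m. row A p \<in> layer (blk p))"
    using J_carrier unfolding layer_def by blast
next
  assume A: "A \<in> carrier_mat m n \<and> (\<forall>p<m. row A p \<in> layer (blk p))"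
  \<comment> \<open>The first \<open>k\<close> rows of \<open>A\<close>, followed by zero
    rows.\<close>
  define B where "B k = mat m n (\<lambda>(p, q). if p < k then A $$ (p, q) else 0)" for k
  have "B k \<in> J" if "k \<le> m" for k
    using that
  proof (induction k)
    case 0
    have "B 0 = 0\<^sub>m m n" by (intro eq_matI) (auto simp: B_def)
    then show ?case using J_zero by simp
  next
    case (Suc k)
    then have "single k (row A k) \<in> J" using A mem_layer by simp
    moreover have "B (Suc k) = B k + single k (row A k)"
      using A Suc by (intro eq_matI) (auto simp: B_def single_def)
    ultimately show ?case using Suc J_add by simp
  qed
  moreover have "B m = A" using A by (intro eq_matI) (auto simp: B_def)
  ultimately show "A \<in> J" by (metis order_refl)
qed

text \<open>Both sets of matrices are given by a subspace for the rows of each block; matrices with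
  one nonzero row show that equal sets have equal subspaces.\<close>

lemma generates_iff:
  assumes A: "A \<in> J"
  shows "J = {mmul T A | T. T \<in> tri m blk} \<longleftrightarrow> (\<forall>i\<in>{1..r}. layer i = tail m n blk A i)"
    (is "?G \<longleftrightarrow> ?T")
proof
  have Ac: "A \<in> carrier_mat m n" using A J_carrier by blast
  note image = mmul_tri_image[OF Ac, of blk]
  {
    assume G: ?G
    show ?T
    proof
      fix i assume "i \<in> {1..r}"
      then obtain p where p: "p < m" "blk p = i" using blk_surj by auto
      have "v \<in> layer i \<longleftrightarrow> v \<in> tail m n blk A i" if v: "v \<in> carrier_vec n" for v
      proof -
        have "v \<in> layer i \<longleftrightarrow> single p v \<in> J" using mem_layer[OF p] v by simp
        also have "\<dots> \<longleftrightarrow> (\<forall>q<m. row (single p v) q \<in> tail m n blk A (blk q))"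
          unfolding G image by (simp add: single_def)
        also have "\<dots> \<longleftrightarrow> v \<in> tail m n blk A i"
          using row_single[OF v] p subspaceD(3)[OF subspace_tail[OF Ac]] by auto
        finally show ?thesis .
      qed
      then show "layer i = tail m n blk A i"
        using mem_layer[OF p] subspaceD(1)[OF subspace_tail[OF Ac]] by blast
    qed
  next
    assume T: ?T
    have "X \<in> J \<longleftrightarrow> X \<in> {mmul T A | T. T \<in> tri m blk}" for X
      unfolding image using T blk_le blk_ge by (auto simp: mem_J)
    then show ?G by blast
  }
qed

lemma tail_outside: "tail m n blk A (Suc r) = {0\<^sub>v n}"
proof -
  have empty: "{p. p < m \<and> Suc r \<le> blk p} = {}" using blk_le by fastforce
  show ?thesis unfolding tail_def empty by (simp add: extend_empty)
qed

text \<open>Layers and tails obey the same recursion (\<open>tail_Suc\<close>) and both are zero at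
  \<open>Suc r\<close>, so descending induction identifies them.\<close>

lemma layer_eq_tail:
  assumes A: "A \<in> carrier_mat m n"
    and step: "\<And>i. 1 \<le> i \<Longrightarrow> i \<le> r \<Longrightarrow>
      layer i = extend n (layer (Suc i)) {p. p < m \<and> blk p = i} (row A)"
    and i: "1 \<le> i" "i \<le> Suc r"
  shows "layer i = tail m n blk A i"
  using i(2,1)
proof (induction i rule: inc_induct)
  case base
  show ?case by (simp add: layer_outside tail_outside)
next
  case (step i)
  then show ?case using assms(2)[of i] tail_Suc[OF A, of blk i] by simp
qed

text \<open>The rows of a generator in block \<open>i\<close> extend \<open>layer (Suc i)\<close> to
  \<open>layer i\<close>, which limits the growth of the dimension by their number. Conversely
  \<open>ex_extend\<close> supplies such rows for each block separately.\<close>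

theorem principal_iff:
  "(\<exists>A\<in>J. J = {mmul T A | T. T \<in> tri m blk}) \<longleftrightarrow>
    (\<forall>i\<in>{1..r}. pdim n (layer i) \<le> pdim n (layer (Suc i)) + card {p. p < m \<and> blk p = i})"
    (is "?G \<longleftrightarrow> ?D")
proof
  let ?I = "\<lambda>i. {p. p < m \<and> blk p = i}"
  assume ?G
  then obtain A where A: "A \<in> J" "J = {mmul T A | T. T \<in> tri m blk}" by blast
  then have Ac: "A \<in> carrier_mat m n" using J_carrier by blast
  have lt: "layer i = tail m n blk A i" if "i \<in> {1..r}" for i
    using generates_iff[OF A(1)] A(2) that by blast
  \<comment> \<open>For \<open>i = r\<close> the index leaves the range of
    \<open>generates_iff\<close>; both spaces are zero there.\<close>
  have lt': "layer (Suc i) = tail m n blk A (Suc i)" if "i \<in> {1..r}" for i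
    using lt[of "Suc i"] that layer_outside[of "Suc i"] tail_outside by (cases "i = r") auto
  show ?D
  proof
    fix i assume i: "i \<in> {1..r}"
    show "pdim n (layer i) \<le> pdim n (layer (Suc i)) + card (?I i)"
      unfolding lt[OF i] lt'[OF i] tail_Suc[OF Ac, of blk i]
      using Ac by (intro subspace_extend(2) subspace_tail) auto
  qed
next
  let ?I = "\<lambda>i. {p. p < m \<and> blk p = i}"
  assume D: ?D
  have "\<exists>u. i \<in> {1..r} \<longrightarrow> (\<forall>p. u p \<in> layer i) \<and> extend n (layer (Suc i)) (?I i) u = layer i" for i
    using ex_extend[of n "layer i" "?I i" "layer (Suc i)"] subspace_layer layer_Suc_subset D
    by fastforce
  then obtain u where u: "\<And>i p. i \<in> {1..r} \<Longrightarrow> u i p \<in> layer i"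
    "\<And>i. i \<in> {1..r} \<Longrightarrow> extend n (layer (Suc i)) (?I i) (u i) = layer i"
    by metis
  \<comment> \<open>Each row is taken from the family chosen for its own block.\<close>
  define A where "A = mat m n (\<lambda>(p, q). u (blk p) p $ q)"
  have Ac: "A \<in> carrier_mat m n" by (simp add: A_def)
  have row: "row A p = u (blk p) p" if "p < m" for p
  proof -
    have "blk p \<in> {1..r}" using blk_ge blk_le that by simp
    then have "u (blk p) p \<in> carrier_vec n"
      using u(1) subspaceD(1)[OF subspace_layer] by auto
    then show ?thesis using that by (intro eq_vecI) (auto simp: A_def)
  qed
  have AJ: "A \<in> J" unfolding mem_J using Ac row u(1) blk_ge blk_le by simp
  have step: "layer i = extend n (layer (Suc i)) (?I i) (row A)" if "1 \<le> i" "i \<le> r" for i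
    using u(2)[of i] that extend_cong[of "?I i" "u i" "row A" n "layer (Suc i)"] row by auto
  have "layer i = tail m n blk A i" if "i \<in> {1..r}" for i
    by (rule layer_eq_tail[OF Ac step]) (use that in auto)
  then show ?G using generates_iff[OF AJ] AJ by blast
qed

end

section \<open>Blocks\<close>

lemma total_size_mono: "i \<le> j \<Longrightarrow> total_size i M \<le> total_size j M"
  unfolding total_size_def by (intro sum_mono2) auto

lemma total_size_Suc: "total_size (Suc i) M = total_size i M + M (Suc i)"
  by (simp add: total_size_def)

lemma total_size_pred: "1 \<le> i \<Longrightarrow> total_size i M = total_size (i - 1) M + M i"
  using total_size_Suc[of "i - 1" M] by simp

lemma pick_interval: "k < b - a \<Longrightarrow> pick {a..<b} k = a + k" for a b :: nat
proof -
  assume k: "k < b - a"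
  have "{x \<in> {a..<b}. x < a + k} = {a..<a + k}" using k by auto
  then show ?thesis using pick_card_in_set[of "a + k" "{a..<b}"] k by simp
qed

lemma submatrix_interval:
  assumes "b \<le> dim_row A" "d \<le> dim_col A"
  shows "submatrix A {a..<b} {c..<d} = mat (b - a) (d - c) (\<lambda>(i, j). A $$ (a + i, c + j))"
proof -
  have "{i. i < dim_row A \<and> i \<in> {a..<b}} = {a..<b}" "{i. i < dim_col A \<and> i \<in> {c..<d}} = {c..<d}"
    using assms by auto
  then show ?thesis by (intro eq_matI) (auto simp: submatrix_def pick_interval)
qed

lemma submatrix_interval_UNIV:
  assumes "b \<le> dim_row A"
  shows "submatrix A {a..<b} UNIV = mat (b - a) (dim_col A) (\<lambda>(i, j). A $$ (a + i, j))"
proof -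
  have "{i. i < dim_row A \<and> i \<in> {a..<b}} = {a..<b}" using assms by auto
  then show ?thesis by (intro eq_matI) (auto simp: submatrix_def pick_interval pick_UNIV)
qed

lemma transpose_block_col: "transpose_mat (block_col N j A) = block_row N j (transpose_mat A)"
proof -
  show ?thesis unfolding block_col_def block_row_def
    by (intro eq_matI) (auto simp: submatrix_def pick_UNIV pick_le)
qed

text \<open>The number of the block that contains index \<open>p\<close>. It is never 0, as
  \<open>total_size 0 M\<close> is 0, and empty blocks are skipped.\<close>

definition blk_of :: "(nat \<Rightarrow> nat) \<Rightarrow> nat \<Rightarrow> nat" where
  "blk_of M p = (LEAST i. p < total_size i M)"

lemma blk_of_eq:
  assumes "1 \<le> i" "p \<in> block_indices M i"
  shows "blk_of M p = i"
  unfolding blk_of_def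
proof (rule Least_equality)
  show "p < total_size i M" using assms by (simp add: block_indices_def)
  fix j assume "p < total_size j M"
  show "i \<le> j"
  proof (rule ccontr)
    assume "\<not> i \<le> j"
    then have "total_size j M \<le> total_size (i - 1) M" by (intro total_size_mono) simp
    then show False using assms \<open>p < total_size j M\<close> by (simp add: block_indices_def)
  qed
qed

lemma blk_of_bounds:
  assumes "p < total_size r M"
  shows "1 \<le> blk_of M p" "blk_of M p \<le> r" "p \<in> block_indices M (blk_of M p)"
proof -
  have lt: "p < total_size (blk_of M p) M" unfolding blk_of_def using assms by (rule LeastI)
  have "blk_of M p \<noteq> 0"
  proof
    assume "blk_of M p = 0"
    then show False using lt by (simp add: total_size_def)
  qed
  then show ge: "1 \<le> blk_of M p" by simp
  show "blk_of M p \<le> r" unfolding blk_of_def using assms by (rule Least_le)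
  have "\<not> p < total_size (blk_of M p - 1) M"
    using ge not_less_Least[of "blk_of M p - 1" "\<lambda>i. p < total_size i M"]
    by (simp add: blk_of_def)
  then show "p \<in> block_indices M (blk_of M p)" using lt by (simp add: block_indices_def)
qed

lemma blk_of_iff:
  assumes "p < total_size r M" "1 \<le> i"
  shows "blk_of M p = i \<longleftrightarrow> p \<in> block_indices M i"
  using blk_of_eq blk_of_bounds[OF assms(1)] assms(2) by metis

lemma block_indices_subset:
  assumes "i \<le> r" "p \<in> block_indices M i"
  shows "p < total_size r M"
  using assms total_size_mono[of i r M] by (auto simp: block_indices_def)

lemma card_block_indices: "1 \<le> i \<Longrightarrow> card (block_indices M i) = M i"
  using total_size_pred[of i M] by (simp add: block_indices_def)

text \<open>Replaces vanishing blocks by vanishing entries, the form used in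
  \<open>tri\<close>.\<close>

lemma nest_module_iff:
  "A \<in> nest_module r M s N \<longleftrightarrow> A \<in> carrier_mat (total_size r M) (total_size s N) \<and>
    (\<forall>p<total_size r M. \<forall>q<total_size s N. blk_of N q < blk_of M p \<longrightarrow> A $$ (p, q) = 0)"
proof (cases "A \<in> carrier_mat (total_size r M) (total_size s N)")
  case True
  have zero: "block M N A i j = 0\<^sub>m (M i) (N j) \<longleftrightarrow>
    (\<forall>p\<in>block_indices M i. \<forall>q\<in>block_indices N j. A $$ (p, q) = 0)" (is "?L \<longleftrightarrow> ?R")
    if ij: "i \<in> {1..r}" "j \<in> {1..s}" for i j
  proof -
    define a b where "a = total_size (i - 1) M" and "b = total_size (j - 1) N"
    have I: "block_indices M i = {a..<a + M i}" "block_indices N j = {b..<b + N j}"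
      using total_size_pred[of i M] total_size_pred[of j N] ij
      by (auto simp: a_def b_def block_indices_def)
    have "a + M i \<le> dim_row A" "b + N j \<le> dim_col A"
      using total_size_pred[of i M] total_size_pred[of j N] ij True
        total_size_mono[of i r M] total_size_mono[of j s N] by (auto simp: a_def b_def)
    then have B: "block M N A i j = mat (M i) (N j) (\<lambda>(k, l). A $$ (a + k, b + l))"
      unfolding block_def I by (subst submatrix_interval) auto
    show ?thesis
    proof
      assume L: ?L
      show ?R unfolding I
      proof (intro ballI)
        fix p q assume "p \<in> {a..<a + M i}" "q \<in> {b..<b + N j}"
        then have "p - a < M i" "q - b < N j" "a + (p - a) = p" "b + (q - b) = q" by auto
        then show "A $$ (p, q) = 0"
          using arg_cong[OF L[unfolded B], of "\<lambda>X. X $$ (p - a, q - b)"] by simp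
      qed
    next
      assume ?R
      then show ?L unfolding B I by (intro eq_matI) auto
    qed
  qed
  show ?thesis
  proof
    assume A: "A \<in> nest_module r M s N"
    show "A \<in> carrier_mat (total_size r M) (total_size s N) \<and>
      (\<forall>p<total_size r M. \<forall>q<total_size s N. blk_of N q < blk_of M p \<longrightarrow> A $$ (p, q) = 0)"
    proof (intro conjI allI impI True)
      fix p q assume pq: "p < total_size r M" "q < total_size s N" "blk_of N q < blk_of M p"
      note p = blk_of_bounds[OF pq(1)] and q = blk_of_bounds[OF pq(2)]
      have "block M N A (blk_of M p) (blk_of N q) = 0\<^sub>m (M (blk_of M p)) (N (blk_of N q))"
        using A p q pq(3) by (simp add: nest_module_def)
      then show "A $$ (p, q) = 0" using zero[of "blk_of M p" "blk_of N q"] p q by auto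
    qed
  next
    assume R: "A \<in> carrier_mat (total_size r M) (total_size s N) \<and>
      (\<forall>p<total_size r M. \<forall>q<total_size s N. blk_of N q < blk_of M p \<longrightarrow> A $$ (p, q) = 0)"
    have "block M N A i j = 0\<^sub>m (M i) (N j)" if ij: "i \<in> {1..r}" "j \<in> {1..s}" "j < i" for i j
      unfolding zero[OF ij(1,2)]
    proof (intro ballI)
      fix p q assume pq: "p \<in> block_indices M i" "q \<in> block_indices N j"
      then have "blk_of M p = i" "blk_of N q = j" using ij by (simp_all add: blk_of_eq)
      moreover have "p < total_size r M" "q < total_size s N"
        using pq ij by (auto intro: block_indices_subset)
      ultimately show "A $$ (p, q) = 0" using R ij(3) by blast
    qed
    then show "A \<in> nest_module r M s N" using True by (simp add: nest_module_def)
  qed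
qed (simp add: nest_module_def)

lemma ex_blk_of:
  assumes "1 \<le> i" "i \<le> r" "1 \<le> M i"
  shows "\<exists>p<total_size r M. blk_of M p = i"
proof -
  \<comment> \<open>The first index of the block, which exists because the block is
    nonempty.\<close>
  have "total_size (i - 1) M \<in> block_indices M i"
    using total_size_pred[of i M] assms by (simp add: block_indices_def)
  then show ?thesis using blk_of_eq block_indices_subset assms by blast
qed

lemma card_blk_of:
  assumes "i \<in> {1..r}"
  shows "card {p. p < total_size r M \<and> blk_of M p = i} = M i"
proof -
  have "{p. p < total_size r M \<and> blk_of M p = i} = block_indices M i"
    using assms blk_of_iff[of _ r M i] block_indices_subset[of i r _ M] by auto
  then show ?thesis using card_block_indices assms by simp
qed

section \<open>Principal submodules\<close>

text \<open>\<open>j\<close> numbers the block in the given order, \<open>i\<close> in the order of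
  \<open>blk\<close>: they agree for left submodules and run in opposite directions for right ones.
  A preimage in \<open>J\<close> is obtained by filling the other blocks with zeros.\<close>

lemma (in nest_submodule) block_row_image:
  assumes m: "m = total_size t M" and j: "j \<in> {1..t}"
    and blk: "\<And>p. p < m \<Longrightarrow> blk p = i \<longleftrightarrow> p \<in> block_indices M j"
  shows "block_row M j ` J = {X \<in> carrier_mat (M j) n. \<forall>k<M j. row X k \<in> layer i}"
proof -
  define a where "a = total_size (j - 1) M"
  have I: "block_indices M j = {a..<a + M j}" and le: "a + M j \<le> m"
    using total_size_pred[of j M] j total_size_mono[of j t M]
    by (auto simp: a_def block_indices_def m)
  have B: "block_row M j A = mat (M j) n (\<lambda>(k, q). A $$ (a + k, q))" if "A \<in> carrier_mat m n" for A
    using that le unfolding block_row_def I by (subst submatrix_interval_UNIV) auto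
  show ?thesis
  proof (intro equalityI subsetI)
    fix X assume "X \<in> block_row M j ` J"
    then obtain A where A: "A \<in> J" "X = block_row M j A" by blast
    then have Ac: "A \<in> carrier_mat m n" using J_carrier by blast
    have "row X k \<in> layer i" if k: "k < M j" for k
    proof -
      have ak: "a + k < m" "blk (a + k) = i" using k le blk[of "a + k"] by (auto simp: I)
      have "row X k = row A (a + k)"
        unfolding A(2) B[OF Ac] using k Ac ak by (intro eq_vecI) auto
      then show ?thesis using A(1) ak unfolding mem_J by metis
    qed
    then show "X \<in> {X \<in> carrier_mat (M j) n. \<forall>k<M j. row X k \<in> layer i}"
      using A(2) B[OF Ac] by simp
  next
    fix X assume X: "X \<in> {X \<in> carrier_mat (M j) n. \<forall>k<M j. row X k \<in> layer i}"
    define A where "A = mat m n (\<lambda>(p, q). if p \<in> {a..<a + M j} then X $$ (p - a, q) else 0)"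
    have Ac: "A \<in> carrier_mat m n" by (simp add: A_def)
    have "row A p \<in> layer (blk p)" if p: "p < m" for p
    proof (cases "p \<in> {a..<a + M j}")
      case True
      then have "row A p = row X (p - a)"
        using p X by (intro eq_vecI) (auto simp: A_def)
      then show ?thesis using X True blk[OF p] by (auto simp: I)
    next
      case False
      then have "row A p = 0\<^sub>v n" using p by (intro eq_vecI) (auto simp: A_def)
      then show ?thesis by (simp add: layer_def)
    qed
    then have "A \<in> J" using mem_J Ac by blast
    moreover have "block_row M j A = X"
      unfolding B[OF Ac] using X le by (intro eq_matI) (auto simp: A_def)
    ultimately show "X \<in> block_row M j ` J" by blast
  qed
qed

lemma mat_rank_zero: "mat_rank (0\<^sub>m n n :: 'a::division_ring mat) = 0"
proof -
  have "left_mult.lc n {..<n} c (row (0\<^sub>m n n)) = 0\<^sub>v n" for c :: "nat \<Rightarrow> 'a"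
    by (intro eq_vecI) auto
  then have "left_mult.rowsp (0\<^sub>m n n) = {0\<^sub>v n :: 'a vec}"
    by (auto simp: left_mult.mem_rowsp[of _ n n])
  then show ?thesis using mat_rank_eq[of "0\<^sub>m n n :: 'a mat" n n] left_mult.pdim_zero by simp
qed

section \<open>Left submodules\<close>

lemma nest_ring_eq: "nest_ring r M = left_mult.tri (total_size r M) (blk_of M)"
  by (auto simp: nest_module_iff left_mult.tri_def)

lemma one_in_nest_ring: "1\<^sub>m (total_size r M) \<in> nest_ring r M"
  by (auto simp: nest_module_iff)

lemma left_mmul:
  assumes "T \<in> carrier_mat m k" "A \<in> carrier_mat k n"
  shows "left_mult.mmul T A = T * A"
  using assms by (intro eq_matI) (auto simp: left_mult.mmul_def scalar_prod_def atLeast0LessThan)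

text \<open>Since \<open>R_i\<close> has row space \<open>layer i\<close>, this is
  \<open>principal_iff\<close> with dimensions read as ranks.\<close>

theorem left_principal_iff:
  fixes J :: "'a::division_ring mat set"
  assumes J: "J \<in> left_submodules r M s N" and M: "\<forall>i\<in>{1..r}. 1 \<le> M i"
  shows "left_principal r M s N J \<longleftrightarrow> (\<forall>i\<in>{1..r}.
    mat_rank (left_Phi r M s N J i) \<le> mat_rank (left_Phi r M s N J (i + 1)) + M i)"
proof -
  define m n where "m = total_size r M" and "n = total_size s N"
  have Jsub: "J \<subseteq> nest_module r M s N" and Jc: "J \<subseteq> carrier_mat m n"
    using J by (auto simp: left_submodules_def nest_module_def m_def n_def)
  interpret L: nest_submodule "(*)" m n r "blk_of M" J
  proof
    show "blk_of M p \<le> r" "1 \<le> blk_of M p" if "p < m" for p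
      using that blk_of_bounds unfolding m_def by blast+
    show "\<exists>p<m. blk_of M p = i" if "1 \<le> i" "i \<le> r" for i
      using that M unfolding m_def by (intro ex_blk_of) auto
    show "left_mult.mmul T A \<in> J" if "T \<in> left_mult.tri m (blk_of M)" "A \<in> J" for T A
    proof -
      have "T \<in> nest_ring r M" using that nest_ring_eq m_def by blast
      then have "T * A \<in> J" using J that by (simp add: left_submodules_def)
      moreover have "T \<in> carrier_mat m m" "A \<in> carrier_mat m n"
        using that Jc by (auto simp: left_mult.tri_def)
      ultimately show ?thesis by (simp add: left_mmul)
    qed
  qed (use J Jc in \<open>auto simp: left_submodules_def m_def n_def\<close>)
  have rank: "mat_rank (left_Phi r M s N J i) = left_mult.pdim n (L.layer i)"
    if i: "i \<in> {1..r}" for i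
  proof -
    let ?Q = "\<lambda>R. R \<in> row_reduced_echelon n \<and>
      block_row M i ` J = {X * R | X. X \<in> carrier_mat (M i) n}"
    have V: "left_mult.subspace n (L.layer i)" using L.subspace_layer i by simp
    have Mi: "1 \<le> M i" using M i by blast
    have image: "block_row M i ` J = {X \<in> carrier_mat (M i) n. \<forall>k<M i. row X k \<in> L.layer i}"
      using i by (intro L.block_row_image[of r]) (auto simp: m_def blk_of_iff)
    have mult: "{X * R | X. X \<in> carrier_mat (M i) n} =
        {left_mult.mmul X R | X. X \<in> carrier_mat (M i) n}"
      if "R \<in> carrier_mat n n" for R :: "'a mat"
      using left_mmul[OF _ that] by metis
    have Q: "?Q R \<longleftrightarrow> R \<in> row_reduced_echelon n \<and>
        {X \<in> carrier_mat (M i) n. \<forall>k<M i. row X k \<in> L.layer i} =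
        {left_mult.mmul X R | X. X \<in> carrier_mat (M i) n}" for R :: "'a mat"
    proof (cases "R \<in> carrier_mat n n")
      case True
      show ?thesis unfolding image mult[OF True] ..
    qed (simp add: row_reduced_echelon_def)
    have "\<exists>!R. ?Q R" unfolding Q by (rule left_mult.ex1_row_reduced_echelon(1)[OF V Mi])
    then have "?Q (THE R. ?Q R)" by (rule theI')
    moreover have "left_Phi r M s N J i = (THE R. ?Q R)"
      using i by (simp add: left_Phi_def n_def Let_def)
    ultimately have "?Q (left_Phi r M s N J i)" by simp
    then have "left_mult.rowsp (left_Phi r M s N J i) = L.layer i"
      "left_Phi r M s N J i \<in> carrier_mat n n"
      using left_mult.ex1_row_reduced_echelon(2)[OF V Mi] unfolding Q
      by (auto simp: row_reduced_echelon_def)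
    then show ?thesis using mat_rank_eq by metis
  qed
  \<comment> \<open>At \<open>i = r\<close> the convention that \<open>R_{r+1}\<close> is zero
    matches the zero layer beyond \<open>r\<close>.\<close>
  have rank': "mat_rank (left_Phi r M s N J (Suc i)) = left_mult.pdim n (L.layer (Suc i))"
    if "i \<in> {1..r}" for i
  proof (cases "i = r")
    case True
    then show ?thesis
      using L.layer_outside[of "Suc i"] left_mult.pdim_zero mat_rank_zero[of n, where 'a='a]
      by (simp add: left_Phi_def n_def Let_def)
  qed (use rank that in simp)
  have card: "card {p. p < m \<and> blk_of M p = i} = M i" if "i \<in> {1..r}" for i
    using card_blk_of[OF that] by (simp add: m_def)
  have "left_principal r M s N J \<longleftrightarrow>
    (\<exists>A\<in>J. J = {left_mult.mmul T A | T. T \<in> left_mult.tri m (blk_of M)})"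
  proof -
    have eq: "{T * A | T. T \<in> nest_ring r M} =
        {left_mult.mmul T A | T. T \<in> left_mult.tri m (blk_of M)}" if "A \<in> carrier_mat m n"
      for A :: "'a mat"
      unfolding nest_ring_eq m_def[symmetric]
      using left_mmul[OF _ that] by (auto simp: left_mult.tri_def) metis+
    \<comment> \<open>\<open>left_principal\<close> asks for a generator in the nest module,
      \<open>principal_iff\<close> for one in \<open>J\<close>; the identity matrix in the ring
      closes the gap.\<close>
    have gen: "A \<in> J" if "A \<in> carrier_mat m n" "J = {T * A | T. T \<in> nest_ring r M}" for A
    proof -
      have "1\<^sub>m m * A \<in> J" using that(2) one_in_nest_ring unfolding m_def by blast
      then show ?thesis using that(1) by simp
    qed
    have "left_principal r M s N J \<longleftrightarrow> (\<exists>A\<in>J. J = {T * A | T. T \<in> nest_ring r M})"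
    proof
      assume "left_principal r M s N J"
      then obtain A where A: "A \<in> nest_module r M s N" "J = {T * A | T. T \<in> nest_ring r M}"
        unfolding left_principal_def by blast
      then have "A \<in> J" by (intro gen) (auto simp: nest_module_def m_def n_def)
      then show "\<exists>A\<in>J. J = {T * A | T. T \<in> nest_ring r M}" using A(2) by blast
    qed (use Jsub in \<open>unfold left_principal_def, blast\<close>)
    also have "\<dots> \<longleftrightarrow> (\<exists>A\<in>J. J = {left_mult.mmul T A | T. T \<in> left_mult.tri m (blk_of M)})"
    proof (intro bex_cong refl)
      fix A assume "A \<in> J"
      then have "A \<in> carrier_mat m n" using Jc by blast
      then show "J = {T * A | T. T \<in> nest_ring r M} \<longleftrightarrow>
          J = {left_mult.mmul T A | T. T \<in> left_mult.tri m (blk_of M)}"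
        by (simp only: eq)
    qed
    finally show ?thesis .
  qed
  then show ?thesis using L.principal_iff rank rank' card by simp
qed

section \<open>Right submodules by transposition\<close>

interpretation right_mult: twisted_mult "\<lambda>a b. b * a"
  by unfold_locales simp

text \<open>Transposition swaps the two matrices, and the flipped multiplication restores the order
  of the factors in each entry.\<close>

lemma right_mmul:
  assumes "A \<in> carrier_mat m k" "T \<in> carrier_mat k n"
  shows "right_mult.mmul (transpose_mat T) (transpose_mat A) = transpose_mat (A * T)"
  using assms by (intro eq_matI) (auto simp: right_mult.mmul_def scalar_prod_def atLeast0LessThan)


text \<open>\<open>C_j\<close> belongs to layer \<open>Suc s - j\<close> of the transposed
  submodule, so its predecessor \<open>C_{j-1}\<close> belongs to the next layer.\<close>

theorem right_principal_iff:
  fixes J :: "'a::division_ring mat set"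
  assumes J: "J \<in> right_submodules r M s N" and N: "\<forall>j\<in>{1..s}. 1 \<le> N j"
  shows "right_principal r M s N J \<longleftrightarrow> (\<forall>j\<in>{1..s}.
    mat_rank (right_Phi r M s N J j) \<le> mat_rank (right_Phi r M s N J (j - 1)) + N j)"
proof -
  define m n where "m = total_size r M" and "n = total_size s N"
  \<comment> \<open>Transposes of block upper triangular matrices are lower triangular; counting the
    blocks backwards from \<open>s\<close> to 1 makes them upper triangular again.\<close>
  define blk where "blk q = Suc s - blk_of N q" for q
  define J' where "J' = transpose_mat ` J"
  have Jsub: "J \<subseteq> nest_module r M s N" and Jc: "J \<subseteq> carrier_mat m n"
    using J by (auto simp: right_submodules_def nest_module_def m_def n_def)
  have ring: "T \<in> nest_ring s N \<longleftrightarrow> transpose_mat T \<in> right_mult.tri n blk" for T :: "'a mat"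
  proof -
    have "blk q < blk p \<longleftrightarrow> blk_of N p < blk_of N q" if "p < n" "q < n" for p q
      using that blk_of_bounds(2)[of p s N] blk_of_bounds(2)[of q s N]
      by (auto simp: blk_def n_def)
    then show ?thesis by (auto simp: nest_module_iff right_mult.tri_def n_def)
  qed
  interpret L: nest_submodule "\<lambda>a b. b * a" n m s blk J'
  proof
    fix p assume "p < n"
    then show "blk p \<le> s" "1 \<le> blk p"
      using blk_of_bounds(1,2)[of p s N] unfolding blk_def n_def by auto
  next
    fix i assume i: "1 \<le> i" "i \<le> s"
    then have "Suc s - i \<in> {1..s}" by auto
    then have "\<exists>p<n. blk_of N p = Suc s - i"
      using N unfolding n_def by (intro ex_blk_of) simp_all
    then show "\<exists>p<n. blk p = i" using i unfolding blk_def by force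
  next
    show "J' \<subseteq> carrier_mat n m" using Jc by (auto simp: J'_def)
    have "0\<^sub>m m n \<in> J" using J by (simp add: right_submodules_def m_def n_def)
    then show "0\<^sub>m n m \<in> J'" unfolding J'_def by (metis imageI zero_transpose_mat)
  next
    fix A B assume "A \<in> J'" "B \<in> J'"
    then obtain A0 B0 where AB: "A0 \<in> J" "B0 \<in> J" "A = transpose_mat A0" "B = transpose_mat B0"
      unfolding J'_def by blast
    then have "A + B = transpose_mat (A0 + B0)"
      using Jc by (metis transpose_add subsetD)
    moreover have "A0 + B0 \<in> J" using J AB by (simp add: right_submodules_def)
    ultimately show "A + B \<in> J'" unfolding J'_def by blast
  next
    fix T A :: "'a mat"
    assume T: "T \<in> right_mult.tri n blk" and "A \<in> J'"
    then obtain A0 where A: "A0 \<in> J" "A = transpose_mat A0" unfolding J'_def by blast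
    have "transpose_mat T \<in> nest_ring s N" using T by (simp add: ring)
    then have "A0 * transpose_mat T \<in> J" using J A by (simp add: right_submodules_def)
    moreover have "transpose_mat T \<in> carrier_mat n n" using T by (simp add: right_mult.tri_def)
    then have "right_mult.mmul T A = transpose_mat (A0 * transpose_mat T)"
      using right_mmul[of A0 m n "transpose_mat T" n] A Jc by auto
    ultimately show "right_mult.mmul T A \<in> J'" unfolding J'_def by blast
  qed
  have rank: "mat_rank (right_Phi r M s N J j) = right_mult.pdim m (L.layer (Suc s - j))"
    if j: "j \<in> {1..s}" for j
  proof -
    let ?Q = "\<lambda>C. C \<in> col_reduced_echelon m \<and>
      block_col N j ` J = {C * X | X. X \<in> carrier_mat m (N j)}"
    \<comment> \<open>The defining condition of \<open>C_j\<close>, transposed: it holds for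
      \<open>R\<close> iff the transpose of \<open>R\<close> satisfies the original one.\<close>
    define Q' where "Q' R \<longleftrightarrow> R \<in> row_reduced_echelon m \<and>
      {X \<in> carrier_mat (N j) m. \<forall>k<N j. row X k \<in> L.layer (Suc s - j)} =
        {right_mult.mmul X R | X. X \<in> carrier_mat (N j) m}" for R
    have V: "right_mult.subspace m (L.layer (Suc s - j))"
      using j by (intro L.subspace_layer) auto
    have Nj: "1 \<le> N j" using N j by blast
    have blk_iff: "blk p = Suc s - j \<longleftrightarrow> p \<in> block_indices N j" if "p < n" for p
      using that j blk_of_iff[of p s N j] blk_of_bounds(2)[of p s N] by (auto simp: blk_def n_def)
    have image: "{X \<in> carrier_mat (N j) m. \<forall>k<N j. row X k \<in> L.layer (Suc s - j)} =
        transpose_mat ` block_col N j ` J"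
      using L.block_row_image[OF n_def j blk_iff]
      by (simp add: J'_def image_image transpose_block_col)
    have image': "{right_mult.mmul X (transpose_mat C) | X. X \<in> carrier_mat (N j) m} =
        transpose_mat ` {C * X | X. X \<in> carrier_mat m (N j)}" (is "?L = ?R")
      if C: "C \<in> carrier_mat m m" for C :: "'a mat"
    proof (intro equalityI subsetI)
      fix Y assume "Y \<in> ?L"
      then obtain X where X: "X \<in> carrier_mat (N j) m" "Y = right_mult.mmul X (transpose_mat C)"
        by blast
      then have "Y = transpose_mat (C * transpose_mat X)" "transpose_mat X \<in> carrier_mat m (N j)"
        using right_mmul[OF C, of "transpose_mat X" "N j"] by auto
      then show "Y \<in> ?R" by blast
    next
      fix Y assume "Y \<in> ?R"
      then obtain X where X: "X \<in> carrier_mat m (N j)" "Y = transpose_mat (C * X)" by blast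
      then have "Y = right_mult.mmul (transpose_mat X) (transpose_mat C)"
        "transpose_mat X \<in> carrier_mat (N j) m"
        using right_mmul[OF C X(1)] by auto
      then show "Y \<in> ?L" by blast
    qed
    have inj: "inj (transpose_mat :: 'a mat \<Rightarrow> 'a mat)" by (simp add: inj_def)
    have Q: "?Q C \<longleftrightarrow> Q' (transpose_mat C)" for C :: "'a mat"
    proof (cases "C \<in> carrier_mat m m")
      case True
      then show ?thesis
        unfolding Q'_def image image'[OF True] inj_image_eq_iff[OF inj]
        by (simp add: col_reduced_echelon_def row_reduced_echelon_def)
    qed (simp add: Q'_def col_reduced_echelon_def row_reduced_echelon_def)
    have "\<exists>!R. Q' R"
      unfolding Q'_def by (rule right_mult.ex1_row_reduced_echelon(1)[OF V Nj])
    then obtain R where R: "Q' R" and unique: "\<And>R'. Q' R' \<Longrightarrow> R' = R"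
      by blast
    have "(THE C. ?Q C) = transpose_mat R"
    proof (rule the_equality)
      show "?Q (transpose_mat R)" unfolding Q using R by simp
      show "C = transpose_mat R" if "?Q C" for C
        using unique[of "transpose_mat C"] that unfolding Q by auto
    qed
    then have "right_Phi r M s N J j = transpose_mat R"
      using j by (simp add: right_Phi_def m_def Let_def)
    moreover obtain f where "R \<in> carrier_mat m m" "pivot_fun R f m"
      using R by (auto simp: Q'_def row_reduced_echelon_def row_echelon_form_def)
    moreover have "right_mult.rowsp R = L.layer (Suc s - j)"
      using right_mult.ex1_row_reduced_echelon(2)[OF V Nj] R unfolding Q'_def by blast
    \<comment> \<open>Here the left row rank in \<open>mat_rank\<close> meets the right dimension of
      the layer.\<close>
    ultimately show ?thesis using right_mult.mat_rank_transpose by metis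
  qed
  \<comment> \<open>At \<open>j = 1\<close> the convention that \<open>C_0\<close> is zero matches
    the zero layer at \<open>Suc s\<close>.\<close>
  have rank': "mat_rank (right_Phi r M s N J (j - 1)) =
      right_mult.pdim m (L.layer (Suc (Suc s - j)))" if j: "j \<in> {1..s}" for j
  proof (cases "j = 1")
    case True
    then show ?thesis
      using L.layer_outside[of "Suc s"] right_mult.pdim_zero mat_rank_zero[of m, where 'a='a]
      by (simp add: right_Phi_def m_def Let_def)
  next
    case False
    then have "j - 1 \<in> {1..s}" "Suc s - (j - 1) = Suc (Suc s - j)" using j by auto
    then show ?thesis using rank by metis
  qed
  have card: "card {p. p < n \<and> blk p = Suc s - j} = N j" if j: "j \<in> {1..s}" for j
  proof -
    have "blk p = Suc s - j \<longleftrightarrow> blk_of N p = j" if "p < n" for p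
      using that j blk_of_bounds(2)[of p s N] by (auto simp: blk_def n_def)
    then have "{p. p < n \<and> blk p = Suc s - j} = {p. p < n \<and> blk_of N p = j}" by blast
    then show ?thesis using card_blk_of[OF j] by (simp add: n_def)
  qed
  have "right_principal r M s N J \<longleftrightarrow>
    (\<exists>A\<in>J'. J' = {right_mult.mmul T A | T. T \<in> right_mult.tri n blk})"
  proof -
    have inj: "inj (transpose_mat :: 'a mat \<Rightarrow> 'a mat)" by (simp add: inj_def)
    have eq: "{right_mult.mmul T (transpose_mat A) | T. T \<in> right_mult.tri n blk} =
        transpose_mat ` {A * T | T. T \<in> nest_ring s N}" (is "?L = ?R")
      if A: "A \<in> carrier_mat m n" for A :: "'a mat"
    proof (intro equalityI subsetI)
      fix Y assume "Y \<in> ?L"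
      then obtain T where T: "T \<in> right_mult.tri n blk"
        "Y = right_mult.mmul T (transpose_mat A)" by blast
      then have "transpose_mat T \<in> nest_ring s N" "Y = transpose_mat (A * transpose_mat T)"
        using right_mmul[OF A, of "transpose_mat T" n] by (auto simp: ring right_mult.tri_def)
      then show "Y \<in> ?R" by blast
    next
      fix Y assume "Y \<in> ?R"
      then obtain T where T: "T \<in> nest_ring s N" "Y = transpose_mat (A * T)" by blast
      then have "transpose_mat T \<in> right_mult.tri n blk"
        "Y = right_mult.mmul (transpose_mat T) (transpose_mat A)"
        using right_mmul[OF A, of T n] by (auto simp: ring right_mult.tri_def)
      then show "Y \<in> ?L" by blast
    qed
    have gen: "A \<in> J" if "A \<in> carrier_mat m n" "J = {A * T | T. T \<in> nest_ring s N}" for A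
    proof -
      have "A * 1\<^sub>m n \<in> J" using that(2) one_in_nest_ring unfolding n_def by blast
      then show ?thesis using that(1) by simp
    qed
    have "right_principal r M s N J \<longleftrightarrow> (\<exists>A\<in>J. J = {A * T | T. T \<in> nest_ring s N})"
    proof
      assume "right_principal r M s N J"
      then obtain A where A: "A \<in> nest_module r M s N" "J = {A * T | T. T \<in> nest_ring s N}"
        unfolding right_principal_def by blast
      then have "A \<in> J" by (intro gen) (auto simp: nest_module_def m_def n_def)
      then show "\<exists>A\<in>J. J = {A * T | T. T \<in> nest_ring s N}" using A(2) by blast
    qed (use Jsub in \<open>unfold right_principal_def, blast\<close>)
    also have "\<dots> \<longleftrightarrow> (\<exists>A\<in>J. J' = {right_mult.mmul T (transpose_mat A) | T. T \<in> right_mult.tri n blk})"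
    proof (intro bex_cong refl)
      fix A assume "A \<in> J"
      then have "A \<in> carrier_mat m n" using Jc by blast
      then show "J = {A * T | T. T \<in> nest_ring s N} \<longleftrightarrow>
          J' = {right_mult.mmul T (transpose_mat A) | T. T \<in> right_mult.tri n blk}"
        by (simp only: eq J'_def inj_image_eq_iff[OF inj])
    qed
    finally show ?thesis by (simp add: J'_def)
  qed
  also have "\<dots> \<longleftrightarrow> (\<forall>i\<in>{1..s}. right_mult.pdim m (L.layer i) \<le>
      right_mult.pdim m (L.layer (Suc i)) + card {p. p < n \<and> blk p = i})"
    by (rule L.principal_iff)
  \<comment> \<open>Reindexing by the involution that sends \<open>i\<close> to
    \<open>Suc s - i\<close> on \<open>{1..s}\<close>.\<close>
  also have "\<dots> \<longleftrightarrow> (\<forall>j\<in>{1..s}. right_mult.pdim m (L.layer (Suc s - j)) \<le>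
      right_mult.pdim m (L.layer (Suc (Suc s - j))) + card {p. p < n \<and> blk p = Suc s - j})"
    (is "(\<forall>i\<in>_. ?P i) \<longleftrightarrow> _")
  proof (intro iffI ballI)
    fix i assume P: "\<forall>j\<in>{1..s}. ?P (Suc s - j)" and "i \<in> {1..s}"
    then have "Suc s - i \<in> {1..s}" "Suc s - (Suc s - i) = i" by auto
    then show "?P i" using P by metis
  next
    fix j assume P: "\<forall>i\<in>{1..s}. ?P i" and "j \<in> {1..s}"
    then have "Suc s - j \<in> {1..s}" by auto
    then show "?P (Suc s - j)" using P by blast
  qed
  also have "\<dots> \<longleftrightarrow> (\<forall>j\<in>{1..s}.
      mat_rank (right_Phi r M s N J j) \<le> mat_rank (right_Phi r M s N J (j - 1)) + N j)"
    using rank rank' card by (intro ball_cong refl) presburger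
  finally show ?thesis .
qed

theorem theorem2p6:
  fixes r s m n :: nat and M N :: "nat \<Rightarrow> nat"
  assumes "1 \<le> r" and "1 \<le> s"
    and "\<forall>i\<in>{1..r}. 1 \<le> M i" and "\<forall>j\<in>{1..s}. 1 \<le> N j"
    and "m = total_size r M" and "n = total_size s N"
  shows "(\<forall>(J :: 'a::division_ring mat set) k.
            J \<in> left_submodules r M s N \<and> J \<noteq> {0\<^sub>m m n} \<and>
            k \<in> {1..r} \<and> left_Phi r M s N J k \<noteq> 0\<^sub>m n n \<and>
            (\<forall>i\<in>{k<..r}. left_Phi r M s N J i = 0\<^sub>m n n) \<longrightarrow>
            (left_principal r M s N J \<longleftrightarrow>
              (\<forall>i\<in>{1..k}. int (mat_rank (left_Phi r M s N J i))
                 - int (mat_rank (left_Phi r M s N J (i + 1))) \<le> int (M i)))) \<and>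
         (\<forall>(J :: 'a mat set) k.
            J \<in> right_submodules r M s N \<and> J \<noteq> {0\<^sub>m m n} \<and>
            k \<in> {1..s} \<and> right_Phi r M s N J k \<noteq> 0\<^sub>m m m \<and>
            (\<forall>j\<in>{1..<k}. right_Phi r M s N J j = 0\<^sub>m m m) \<longrightarrow>
            (right_principal r M s N J \<longleftrightarrow>
              (\<forall>j\<in>{k..s}. int (mat_rank (right_Phi r M s N J j))
                 - int (mat_rank (right_Phi r M s N J (j - 1))) \<le> int (N j))))"
proof (intro conjI allI impI; elim conjE)
  fix J :: "'a mat set" and k
  assume J: "J \<in> left_submodules r M s N" and k: "k \<in> {1..r}"
    and zero: "\<forall>i\<in>{k<..r}. left_Phi r M s N J i = 0\<^sub>m n n"
  let ?rank = "\<lambda>i. mat_rank (left_Phi r M s N J i)"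
  \<comment> \<open>Beyond \<open>k\<close> the left side is the rank of a zero matrix, so the
    condition on all blocks reduces to the blocks up to \<open>k\<close>.\<close>
  have "?rank i \<le> ?rank (i + 1) + M i" if "i \<in> {1..r}" "i \<notin> {1..k}" for i
    using that zero mat_rank_zero[of n, where 'a='a] by simp
  then have "(\<forall>i\<in>{1..r}. ?rank i \<le> ?rank (i + 1) + M i) \<longleftrightarrow>
      (\<forall>i\<in>{1..k}. ?rank i \<le> ?rank (i + 1) + M i)"
    using k by (meson atLeastAtMost_iff order.trans)
  also have "\<dots> \<longleftrightarrow> (\<forall>i\<in>{1..k}. int (?rank i) - int (?rank (i + 1)) \<le> int (M i))"
    by (intro ball_cong) auto
  finally show "left_principal r M s N J \<longleftrightarrow>
      (\<forall>i\<in>{1..k}. int (?rank i) - int (?rank (i + 1)) \<le> int (M i))"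
    using left_principal_iff[OF J assms(3)] by blast
next
  fix J :: "'a mat set" and k
  assume J: "J \<in> right_submodules r M s N" and k: "k \<in> {1..s}"
    and zero: "\<forall>j\<in>{1..<k}. right_Phi r M s N J j = 0\<^sub>m m m"
  let ?rank = "\<lambda>j. mat_rank (right_Phi r M s N J j)"
  \<comment> \<open>Dually, the zero matrices are those before \<open>k\<close>. At
    \<open>j = k\<close> the condition remains and bounds the rank of \<open>C_k\<close>
    itself.\<close>
  have "?rank j \<le> ?rank (j - 1) + N j" if "j \<in> {1..s}" "j \<notin> {k..s}" for j
    using that zero mat_rank_zero[of m, where 'a='a] by simp
  then have "(\<forall>j\<in>{1..s}. ?rank j \<le> ?rank (j - 1) + N j) \<longleftrightarrow>
      (\<forall>j\<in>{k..s}. ?rank j \<le> ?rank (j - 1) + N j)"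
    using k by (meson atLeastAtMost_iff order.trans)
  also have "\<dots> \<longleftrightarrow> (\<forall>j\<in>{k..s}. int (?rank j) - int (?rank (j - 1)) \<le> int (N j))"
    by (intro ball_cong) auto
  finally show "right_principal r M s N J \<longleftrightarrow>
      (\<forall>j\<in>{k..s}. int (?rank j) - int (?rank (j - 1)) \<le> int (N j))"
    using right_principal_iff[OF J assms(4)] by blast
qed

end
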